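(* Let $n\geqslant 2$ be an integer and let $\mathcal{E}=\{\eta_i,\rho_i\}_{i=0}^{n-1}$ be a bipartite quantum state ensemble on $\mathcal{H}=\mathbb{C}^{d_{\rm A}}\otimes\mathbb{C}^{d_{\rm B}}$ satisfying $$p_{\rm G}(\mathcal{E})=1,\qquad q_{\rm G}(\mathcal{E})<\frac{2}{n}.$$ Then $p_{\rm G}(\mathcal{E}^{(L)})=1$ for every positive integer $L$, and $\lim_{L\to\infty}p_{\rm L}(\mathcal{E}^{(L)})=\frac1n$.
   Context: Let $\mathcal{H}=\mathbb{C}^{d_{\rm A}}\otimes\mathbb{C}^{d_{\rm B}}$ be a finite-dimensional bipartite Hilbert space, the first factor held by Alice and the second by Bob. A state is a density operator $\rho\succeq 0$, $\operatorname{Tr}\rho=1$. A bipartite quantum state ensemble $\mathcal{E}=\{\eta_i,\rho_i\}_{i=0}^{n-1}$ consists of states $\rho_i$ and prior probabilities $\eta_i\in[0,1]$ with $\sum_i\eta_i=1$. A measurement $\mathcal{M}=\{M_i\}_{i=0}^{n-1}$ is a family of positive-semidefinite operators with $\sum_i M_i=I$. It is a LOCC measurement if it can be realized by local operations and classical communication between Alice and Bob, i.e. by rounds of local quantum instruments of the parties, each chosen depending on previously communicated classical outcomes, with the final index a function of the classical record. The superscript $\mathrm{PT}$ denotes partial transposition: transposition, in a fixed orthonormal product basis, of one fixed party's subsystem. Define $$p_{\rm G}(\mathcal{E})=\max_{\mathcal{M}}\sum_{i=0}^{n-1}\eta_i\operatorname{Tr}(\rho_iM_i),\quad q_{\rm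 G}(\mathcal{E})=\max_{\mathcal{M}}\sum_{i=0}^{n-1}\eta_i\operatorname{Tr}(\rho_i^{\mathrm{PT}}M_i),\quad p_{\rm L}(\mathcal{E})=\max_{\mathrm{LOCC}\ \mathcal{M}}\sum_{i=0}^{n-1}\eta_i\operatorname{Tr}(\rho_iM_i),$$ the first two over all measurements and the third over LOCC measurements (read as a supremum if not attained). For $\mathcal{E}=\{\eta_i,\rho_i\}_{i=0}^{n-1}$, a positive integer $L$, and $\vec c=(c_1,\dots,c_L)\in\mathbb{Z}_n^L$ with $\mathbb{Z}_n=\{0,\dots,n-1\}$, put $\eta_{\vec c}=\prod_{l=1}^L\eta_{c_l}$, $\rho_{\vec c}=\bigotimes_{l=1}^L\rho_{c_l}$, and $\omega_n(\vec c)=\sum_{l=1}^L c_l \pmod n\in\mathbb{Z}_n$. Define $$\eta_i^{(L)}=\sum_{\vec c\in\mathbb{Z}_n^L,\ \omega_n(\vec c)=i}\eta_{\vec c},\qquad \rho_i^{(L)}=\frac{1}{\eta_i^{(L)}}\sum_{\vec c\in\mathbb{Z}_n^L,\ \omega_n(\vec c)=i}\eta_{\vec c}\,\rho_{\vec c},\qquad \mathcal{E}^{(L)}=\{\eta_i^{(L)},\rho_i^{(L)}\}_{i=0}^{n-1}$$ (if $\eta_i^{(L)}=0$, $\rho_i^{(L)}$ is an arbitrary state). $\mathcal{E}^{(L)}$ is regarded as a bipartite ensemble on $\mathcal{H}^{\otimes L}\cong(\mathbb{C}^{d_{\rm A}})^{\otimes L}\otimes(\mathbb{C}^{d_{\rm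 B}})^{\otimes L}$, Alice holding all $L$ copies of $\mathbb{C}^{d_{\rm A}}$ and Bob all $L$ copies of $\mathbb{C}^{d_{\rm B}}$; partial transposition and LOCC for $\mathcal{E}^{(L)}$ are with respect to this bipartition. *)

theory Defs
  imports "Jordan_Normal_Form.Schur_Decomposition" "HOL-Library.FuncSet"
begin

(* Operators on C^d are the complex matrices in carrier_mat d d.  The space C^dA \<otimes> C^dB is
   C^(dA * dB), where the product basis vector e_a \<otimes> e_b has index a * dB + b.
   Ensembles and measurements are families indexed by nat of which only the members i < n matter. *)

definition mat_trace :: "complex mat \<Rightarrow> complex" where
  "mat_trace A = (\<Sum>i<dim_row A. A $$ (i, i))"

definition mat_sum :: "nat \<Rightarrow> ('a \<Rightarrow> complex mat) \<Rightarrow> 'a set \<Rightarrow> complex mat" where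
  "mat_sum d F S = mat d d (\<lambda>(x, y). \<Sum>s\<in>S. F s $$ (x, y))"

(* In the order on the complex numbers used here, 0 \<le> z says that z is real and nonnegative;
   so this includes Hermiticity. *)
definition psd :: "nat \<Rightarrow> complex mat \<Rightarrow> bool" where
  "psd d A \<longleftrightarrow> A \<in> carrier_mat d d \<and> (\<forall>v\<in>carrier_vec d. 0 \<le> (A *\<^sub>v v) \<bullet>c v)"

definition kron :: "complex mat \<Rightarrow> complex mat \<Rightarrow> complex mat" where
  "kron A B = mat (dim_row A * dim_row B) (dim_col A * dim_col B)
     (\<lambda>(x, y). A $$ (x div dim_row B, y div dim_col B) * B $$ (x mod dim_row B, y mod dim_col B))"

(* Transposition of the second factor, in the standard basis. *)
definition partial_transpose :: "nat \<Rightarrow> nat \<Rightarrow> complex mat \<Rightarrow> complex mat" where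
  "partial_transpose dA dB X = mat (dA * dB) (dA * dB)
     (\<lambda>(x, y). X $$ ((x div dB) * dB + y mod dB, (y div dB) * dB + x mod dB))"

definition density_operator :: "nat \<Rightarrow> complex mat \<Rightarrow> bool" where
  "density_operator d \<rho> \<longleftrightarrow> psd d \<rho> \<and> mat_trace \<rho> = 1"

definition ensemble :: "nat \<Rightarrow> nat \<Rightarrow> (nat \<Rightarrow> real) \<Rightarrow> (nat \<Rightarrow> complex mat) \<Rightarrow> bool" where
  "ensemble d n \<eta> \<rho> \<longleftrightarrow>
     (\<forall>i<n. density_operator d (\<rho> i)) \<and> (\<forall>i<n. 0 \<le> \<eta> i \<and> \<eta> i \<le> 1) \<and> (\<Sum>i<n. \<eta> i) = 1"

definition measurement :: "nat \<Rightarrow> nat \<Rightarrow> (nat \<Rightarrow> complex mat) \<Rightarrow> bool" where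
  "measurement d n M \<longleftrightarrow> (\<forall>i<n. psd d (M i)) \<and> mat_sum d M {..<n} = 1\<^sub>m d"

(* A quantum instrument on C^d with outcomes k < m, given by Kraus operators: outcome k is the
   completely positive map X \<mapsto> (\<Sum>j<r k. K k j * X * mat_adjoint (K k j)) from operators on C^d to
   operators on C^(d' k), and the sum of these maps over k preserves the trace. *)
definition instrument ::
  "nat \<Rightarrow> nat \<Rightarrow> (nat \<Rightarrow> nat) \<Rightarrow> (nat \<Rightarrow> nat) \<Rightarrow> (nat \<Rightarrow> nat \<Rightarrow> complex mat) \<Rightarrow> bool" where
  "instrument d m r d' K \<longleftrightarrow>
     (\<forall>k<m. 0 < d' k \<and> (\<forall>j<r k. K k j \<in> carrier_mat (d' k) d)) \<and>
     mat_sum d (\<lambda>(k, j). mat_adjoint (K k j) * K k j) (SIGMA k:{..<m}. {..<r k}) = 1\<^sub>m d"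

(* The families M realized by finite LOCC protocols on C^dA \<otimes> C^dB.  A protocol either stops and
   announces an index, or one party applies an instrument and communicates its outcome k, after
   which a protocol depending on k, with measurement operators N k i, is run on the
   post-measurement space.  M is obtained by pulling N back in the Heisenberg picture. *)
inductive locc :: "nat \<Rightarrow> nat \<Rightarrow> nat \<Rightarrow> (nat \<Rightarrow> complex mat) \<Rightarrow> bool" for n :: nat where
  announce: "i\<^sub>0 < n \<Longrightarrow>
    locc n dA dB (\<lambda>i. if i = i\<^sub>0 then 1\<^sub>m (dA * dB) else 0\<^sub>m (dA * dB) (dA * dB))"
| alice: "instrument dA m r d' K \<Longrightarrow> (\<forall>k<m. locc n (d' k) dB (N k)) \<Longrightarrow>
    locc n dA dB (\<lambda>i. mat_sum (dA * dB)
      (\<lambda>(k, j). mat_adjoint (kron (K k j) (1\<^sub>m dB)) * N k i * kron (K k j) (1\<^sub>m dB))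
      (SIGMA k:{..<m}. {..<r k}))"
| bob: "instrument dB m r d' K \<Longrightarrow> (\<forall>k<m. locc n dA (d' k) (N k)) \<Longrightarrow>
    locc n dA dB (\<lambda>i. mat_sum (dA * dB)
      (\<lambda>(k, j). mat_adjoint (kron (1\<^sub>m dA) (K k j)) * N k i * kron (1\<^sub>m dA) (K k j))
      (SIGMA k:{..<m}. {..<r k}))"

definition locc_measurement :: "nat \<Rightarrow> nat \<Rightarrow> nat \<Rightarrow> (nat \<Rightarrow> complex mat) \<Rightarrow> bool" where
  "locc_measurement dA dB n M \<longleftrightarrow> measurement (dA * dB) n M \<and> locc n dA dB M"

(* The traces below are real, being traces of products of two Hermitian operators. *)
definition success ::
  "nat \<Rightarrow> (nat \<Rightarrow> real) \<Rightarrow> (nat \<Rightarrow> complex mat) \<Rightarrow> (nat \<Rightarrow> complex mat) \<Rightarrow> real" where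
  "success n \<eta> X M = (\<Sum>i<n. \<eta> i * Re (mat_trace (X i * M i)))"

definition p_G :: "nat \<Rightarrow> nat \<Rightarrow> nat \<Rightarrow> (nat \<Rightarrow> real) \<Rightarrow> (nat \<Rightarrow> complex mat) \<Rightarrow> real" where
  "p_G dA dB n \<eta> \<rho> = (SUP M\<in>{M. measurement (dA * dB) n M}. success n \<eta> \<rho> M)"

definition q_G :: "nat \<Rightarrow> nat \<Rightarrow> nat \<Rightarrow> (nat \<Rightarrow> real) \<Rightarrow> (nat \<Rightarrow> complex mat) \<Rightarrow> real" where
  "q_G dA dB n \<eta> \<rho> =
     (SUP M\<in>{M. measurement (dA * dB) n M}. success n \<eta> (\<lambda>i. partial_transpose dA dB (\<rho> i)) M)"

definition p_L :: "nat \<Rightarrow> nat \<Rightarrow> nat \<Rightarrow> (nat \<Rightarrow> real) \<Rightarrow> (nat \<Rightarrow> complex mat) \<Rightarrow> real" where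
  "p_L dA dB n \<eta> \<rho> = (SUP M\<in>{M. locc_measurement dA dB n M}. success n \<eta> \<rho> M)"

(* The strings (c 0, ..., c (L - 1)) over {0, ..., n - 1} whose sum is i modulo n. *)
definition strings :: "nat \<Rightarrow> nat \<Rightarrow> nat \<Rightarrow> (nat \<Rightarrow> nat) set" where
  "strings n L i = {c \<in> {..<L} \<rightarrow>\<^sub>E {..<n}. (\<Sum>l<L. c l) mod n = i}"

definition string_prior :: "(nat \<Rightarrow> real) \<Rightarrow> nat \<Rightarrow> (nat \<Rightarrow> nat) \<Rightarrow> real" where
  "string_prior \<eta> L c = (\<Prod>l<L. \<eta> (c l))"

(* (C^dA)^(\<otimes>L) is C^(dA^L), where the product basis vector with l-th component e_(a_l) has
   index (\<Sum>l<L. a_l * dA^l); likewise for dB.  From a basis index x of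
   C^(dA^L) \<otimes> C^(dB^L), copy_index recovers the basis index a_l * dB + b_l of the l-th copy of
   C^dA \<otimes> C^dB. *)
definition copy_index :: "nat \<Rightarrow> nat \<Rightarrow> nat \<Rightarrow> nat \<Rightarrow> nat \<Rightarrow> nat" where
  "copy_index dA dB L l x =
     ((x div dB ^ L) div dA ^ l mod dA) * dB + (x mod dB ^ L) div dB ^ l mod dB"

(* The tensor product of the \<rho> (c l) over l < L, regrouped as an operator on
   (C^dA)^(\<otimes>L) \<otimes> (C^dB)^(\<otimes>L). *)
definition string_state ::
  "nat \<Rightarrow> nat \<Rightarrow> (nat \<Rightarrow> complex mat) \<Rightarrow> nat \<Rightarrow> (nat \<Rightarrow> nat) \<Rightarrow> complex mat" where
  "string_state dA dB \<rho> L c = mat (dA ^ L * dB ^ L) (dA ^ L * dB ^ L)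
     (\<lambda>(x, y). \<Prod>l<L. \<rho> (c l) $$ (copy_index dA dB L l x, copy_index dA dB L l y))"

definition multi_prior :: "nat \<Rightarrow> (nat \<Rightarrow> real) \<Rightarrow> nat \<Rightarrow> nat \<Rightarrow> real" where
  "multi_prior n \<eta> L i = (\<Sum>c\<in>strings n L i. string_prior \<eta> L c)"

(* \<sigma> i is the state used for those i that have prior probability 0. *)
definition multi_state ::
  "nat \<Rightarrow> nat \<Rightarrow> nat \<Rightarrow> (nat \<Rightarrow> real) \<Rightarrow> (nat \<Rightarrow> complex mat) \<Rightarrow> nat \<Rightarrow> (nat \<Rightarrow> complex mat) \<Rightarrow>
     nat \<Rightarrow> complex mat" where
  "multi_state dA dB n \<eta> \<rho> L \<sigma> i =
     (if multi_prior n \<eta> L i = 0 then \<sigma> i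
      else complex_of_real (1 / multi_prior n \<eta> L i) \<cdot>\<^sub>m
        mat_sum (dA ^ L * dB ^ L)
          (\<lambda>c. complex_of_real (string_prior \<eta> L c) \<cdot>\<^sub>m string_state dA dB \<rho> L c) (strings n L i))"

end

theory Submission
  imports Defs "HOL-Analysis.L2_Norm"
begin

text \<open>
  Write \<open>X i\<close> for \<open>\<eta> i\<close> times the partial transpose of \<open>\<rho> i\<close>, let \<open>w\<close> be a primitive \<open>n\<close>-th root of
  unity and \<open>Y k = \<Sum>i<n. w^(k i) X i\<close>.  A contraction \<open>U\<close> turns into the measurement with elements
  \<open>(1/n) (1 + Re (w^(k i) U))\<close>, whose success on the \<open>X i\<close> is \<open>(1/n) (1 + Re Tr (U Y k))\<close>.  So
  \<open>q_G < 2/n\<close> bounds the trace norm of \<open>Y k\<close> for \<open>k \<noteq> 0\<close> by \<open>t = n q_G - 1 < 1\<close>; no duality for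
  \<open>q_G\<close> is needed.  LOCC measurements have a positive partial transpose, which lets one move the
  transposition to the states, and by Fourier inversion over the integers modulo \<open>n\<close> the transposed
  \<open>L\<close>-copy ensemble is a combination of the \<open>L\<close>-th tensor powers of the \<open>Y k\<close>.  The term \<open>k = 0\<close>
  contributes \<open>1/n\<close> to the success and the others at most \<open>n t^L\<close>, because the trace norm is
  multiplicative.  Perfect discrimination of \<open>L\<close> copies is approximated by measuring each copy
  nearly optimally and adding the outcomes modulo \<open>n\<close>.
\<close>

section \<open>Positive semidefinite forms on finite index sets\<close>

text \<open>\<open>q_G\<close> has no evident product rule over copies, while the trace norm has
  one; hence the detour through \<open>Y k\<close>. Partial transposes of states need not be
  positive, so the nontrivial Fourier terms cannot be controlled by traces alone. The threshold
  \<open>2 / n\<close> is where the bound \<open>n * q_G - 1\<close> reaches 1, and that bound is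
  \<open>1 / n * (1 + cmod (Tr (U Y))) <= q_G\<close> solved for the trace. The trace norm enters
  only by duality, as a bound on traces against all contractions. This is the form in which a
  measurement built from \<open>U\<close> delivers it, and it makes multiplicativity provable
  without singular values. Likewise Gram vectors replace the spectral theorem. Operators are
  functions of two indices from an arbitrary finite set. The \<open>L\<close>-fold tensor power then
  lives on extensional functions, induction on \<open>L\<close> splits off one coordinate, and
  regrouping the factors of Alice and Bob is a single bijection of index sets. The lower bound on
  \<open>p_L\<close> takes no communication: some index has prior at least \<open>1 / n\<close>, and
  it is always announced.\<close>

definition form :: "'a set \<Rightarrow> ('a \<Rightarrow> 'a \<Rightarrow> complex) \<Rightarrow> ('a \<Rightarrow> complex) \<Rightarrow> ('a \<Rightarrow> complex) \<Rightarrow> complex" where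
  "form S A u v = (\<Sum>x\<in>S. \<Sum>y\<in>S. cnj (u x) * A x y * v y)"

definition psd_on :: "'a set \<Rightarrow> ('a \<Rightarrow> 'a \<Rightarrow> complex) \<Rightarrow> bool" where
  "psd_on S A \<longleftrightarrow> (\<forall>v. 0 \<le> form S A v v)"

definition trace_prod :: "'a set \<Rightarrow> ('a \<Rightarrow> 'a \<Rightarrow> complex) \<Rightarrow> ('a \<Rightarrow> 'a \<Rightarrow> complex) \<Rightarrow> complex" where
  "trace_prod S A B = (\<Sum>x\<in>S. \<Sum>y\<in>S. A x y * B y x)"

lemma form_cong:
  assumes "\<And>x y. x \<in> S \<Longrightarrow> y \<in> S \<Longrightarrow> A x y = B x y"
    and "\<And>x. x \<in> S \<Longrightarrow> u x = u' x" "\<And>x. x \<in> S \<Longrightarrow> v x = v' x"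
  shows "form S A u v = form S B u' v'"
  unfolding form_def using assms by (intro sum.cong refl) auto

lemma sum_rotate:
  "(\<Sum>x\<in>S. \<Sum>y\<in>T. \<Sum>i\<in>I. f x y i) = (\<Sum>i\<in>I. \<Sum>x\<in>S. \<Sum>y\<in>T. f x y i)"
proof -
  have "(\<Sum>x\<in>S. \<Sum>y\<in>T. \<Sum>i\<in>I. f x y i) = (\<Sum>x\<in>S. \<Sum>i\<in>I. \<Sum>y\<in>T. f x y i)"
    by (intro sum.cong refl sum.swap)
  also have "\<dots> = (\<Sum>i\<in>I. \<Sum>x\<in>S. \<Sum>y\<in>T. f x y i)" by (rule sum.swap)
  finally show ?thesis .
qed

lemma form_alt: "form S A u v = (\<Sum>x\<in>S. cnj (u x) * (\<Sum>y\<in>S. A x y * v y))"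
  by (simp add: form_def sum_distrib_left mult.assoc)

lemma form_bij:
  assumes "bij_betw h T S"
  shows "form T (\<lambda>x y. W (h x) (h y)) (\<lambda>x. u (h x)) (\<lambda>x. v (h x)) = form S W u v"
proof -
  have "form T (\<lambda>x y. W (h x) (h y)) (\<lambda>x. u (h x)) (\<lambda>x. v (h x))
      = (\<Sum>x\<in>T. \<Sum>y\<in>S. cnj (u (h x)) * W (h x) y * v y)"
    unfolding form_def
    by (intro sum.cong refl
        sum.reindex_bij_betw[OF assms, where g = "\<lambda>y. cnj (u (h x)) * W (h x) y * v y" for x])
  also have "\<dots> = form S W u v"
    unfolding form_def
    by (rule sum.reindex_bij_betw[OF assms, where g = "\<lambda>x. \<Sum>y\<in>S. cnj (u x) * W x y * v y"])
  finally show ?thesis .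
qed

lemma form_bij':
  assumes "bij_betw h T S"
  shows "form T (\<lambda>x y. W (h x) (h y)) u v = form S W (\<lambda>z. u (inv_into T h z)) (\<lambda>z. v (inv_into T h z))"
proof -
  have "form T (\<lambda>x y. W (h x) (h y)) u v
      = form T (\<lambda>x y. W (h x) (h y)) (\<lambda>x. u (inv_into T h (h x))) (\<lambda>x. v (inv_into T h (h x)))"
    using assms by (intro form_cong) (auto simp: bij_betw_def)
  also have "\<dots> = form S W (\<lambda>z. u (inv_into T h z)) (\<lambda>z. v (inv_into T h z))"
    by (rule form_bij[OF assms])
  finally show ?thesis .
qed

lemma psd_on_bij:
  assumes "bij_betw h T S" "psd_on S A"
  shows "psd_on T (\<lambda>x y. A (h x) (h y))"
  using assms(2) by (simp add: psd_on_def form_bij'[OF assms(1)])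

lemma psd_on_cong:
  assumes "\<And>x y. x \<in> S \<Longrightarrow> y \<in> S \<Longrightarrow> A x y = B x y"
  shows "psd_on S A \<longleftrightarrow> psd_on S B"
proof -
  have "form S A v v = form S B v v" for v by (rule form_cong) (auto simp: assms)
  then show ?thesis by (simp add: psd_on_def)
qed

lemma form_sum: "form S (\<lambda>x y. \<Sum>i\<in>I. A i x y) u v = (\<Sum>i\<in>I. form S (A i) u v)"
proof -
  have "form S (\<lambda>x y. \<Sum>i\<in>I. A i x y) u v = (\<Sum>x\<in>S. \<Sum>y\<in>S. \<Sum>i\<in>I. cnj (u x) * A i x y * v y)"
    by (simp add: form_def sum_distrib_left sum_distrib_right)
  also have "\<dots> = (\<Sum>i\<in>I. form S (A i) u v)"
    unfolding form_def by (rule sum_rotate)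
  finally show ?thesis .
qed

lemma psd_on_sum: "(\<And>i. i \<in> I \<Longrightarrow> psd_on S (A i)) \<Longrightarrow> psd_on S (\<lambda>x y. \<Sum>i\<in>I. A i x y)"
  by (simp add: psd_on_def form_sum sum_nonneg)

lemma sum_two:
  fixes g :: "'a \<Rightarrow> complex"
  assumes "finite S" "x \<in> S" "y \<in> S" "x \<noteq> y"
  shows "(\<Sum>z\<in>S. (if z = x then a else if z = y then b else 0) * g z) = a * g x + b * g y"
proof -
  have "(\<Sum>z\<in>S. (if z = x then a else if z = y then b else 0) * g z)
      = (\<Sum>z\<in>S. (if z = x then a * g z else 0) + (if z = y then b * g z else 0))"
    using assms(4) by (intro sum.cong) auto
  then show ?thesis using assms by (simp add: sum.distrib)
qed

lemma form_two:
  fixes A :: "'a \<Rightarrow> 'a \<Rightarrow> complex"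
  assumes "finite S" "x \<in> S" "y \<in> S" "x \<noteq> y"
  defines "v \<equiv> (\<lambda>a b z. if z = x then a else if z = y then b else 0)"
  shows "form S A (v a b) (v c d)
    = cnj a * A x x * c + cnj a * A x y * d + cnj b * A y x * c + cnj b * A y y * d"
proof -
  have "(\<Sum>w\<in>S. A z w * v c d w) = c * A z x + d * A z y" for z
    using sum_two[OF assms(1-4), of c d "A z"] by (simp add: v_def mult.commute)
  moreover have "cnj (v a b z) = (if z = x then cnj a else if z = y then cnj b else 0)" for z
    by (simp add: v_def)
  ultimately have "form S A (v a b) (v c d)
      = (\<Sum>z\<in>S. (if z = x then cnj a else if z = y then cnj b else 0) * (c * A z x + d * A z y))"
    by (simp add: form_alt)
  also have "\<dots> = cnj a * (c * A x x + d * A x y) + cnj b * (c * A y x + d * A y y)"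
    using sum_two[OF assms(1-4), of "cnj a" "cnj b" "\<lambda>z. c * A z x + d * A z y"] by simp
  finally show ?thesis by (simp add: algebra_simps)
qed

lemma form_single:
  assumes "finite S" "x \<in> S" "y \<in> S"
  shows "form S A (\<lambda>z. if z = x then 1 else 0) (\<lambda>z. if z = y then 1 else 0) = A x y"
proof -
  have "form S A (\<lambda>z. if z = x then 1 else 0) (\<lambda>z. if z = y then 1 else 0)
     = (\<Sum>z\<in>S. if z = x then A z y else 0)"
    unfolding form_alt using assms(1,3)
    by (intro sum.cong refl) (simp add: if_distrib cong: if_cong)
  then show ?thesis using assms by simp
qed

lemma psd_on_diag: "finite S \<Longrightarrow> psd_on S A \<Longrightarrow> x \<in> S \<Longrightarrow> 0 \<le> A x x"
  using form_single[of S x x A] by (metis psd_on_def)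

text \<open>Polarization: the diagonal is real, and the form is real at \<open>e_x + e_y\<close> and
  at \<open>e_x + i e_y\<close>. The first fact relates the imaginary parts of the two entries, the
  second their real parts.\<close>

lemma psd_on_hermitian:
  assumes "finite S" "psd_on S A" "x \<in> S" "y \<in> S"
  shows "A y x = cnj (A x y)"
proof (cases "x = y")
  case True
  then show ?thesis using psd_on_diag[OF assms(1-3)]
    by (simp add: complex_eq_iff less_eq_complex_def)
next
  case False
  have d: "Im (A x x) = 0" "Im (A y y) = 0"
    using psd_on_diag[OF assms(1,2)] assms(3,4) by (auto simp: less_eq_complex_def)
  have p: "0 \<le> cnj a * A x x * a + cnj a * A x y * b + cnj b * A y x * a + cnj b * A y y * b" for a b
    using assms(2) unfolding psd_on_def form_two[OF assms(1,3,4) False, of A a b a b, symmetric] by blast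
  have "Im (A x y) = - Im (A y x)"
    using p[of 1 1] d by (simp add: less_eq_complex_def)
  moreover have "Re (A x y) = Re (A y x)"
    using p[of 1 \<i>] d by (simp add: less_eq_complex_def)
  ultimately show ?thesis by (simp add: complex_eq_iff)
qed

text \<open>At \<open>e_x - t * cnj (A x s) e_s\<close> the quadratic term in \<open>t\<close>
  carries the factor \<open>A s s = 0\<close>. What is left is affine in \<open>t\<close> with slope
  \<open>-2 * N\<close>, where \<open>N\<close> is the squared modulus of \<open>A x s\<close>, and
  it stays nonnegative for all real \<open>t\<close> only if \<open>N = 0\<close>.\<close>

lemma psd_on_zero_diag:
  assumes "finite S" "psd_on S A" "x \<in> S" "s \<in> S" "A s s = 0"
  shows "A x s = 0"
proof (cases "x = s")
  case True
  then show ?thesis using assms(5) by simp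
next
  case False
  define v where "v = (\<lambda>a b z. if z = x then a else if z = s then b else (0::complex))"
  define N where "N = Re (A x s)^2 + Im (A x s)^2"
  have N: "A x s * cnj (A x s) = of_real N"
    unfolding N_def by (simp add: complex_mult_cnj)
  have h: "A s x = cnj (A x s)" using psd_on_hermitian[OF assms(1-4)] .
  have "2 * t * N \<le> Re (A x x)" for t :: real
  proof -
    have "0 \<le> A x x + A x s * (- (of_real t * cnj (A x s))) + cnj (- (of_real t * cnj (A x s))) * A s x"
      using spec[OF assms(2)[unfolded psd_on_def], of "v 1 (- (of_real t * cnj (A x s)))"] assms(5)
        form_two[OF assms(1,3,4) False, of A 1 "- (of_real t * cnj (A x s))" 1 "- (of_real t * cnj (A x s))"]
      by (simp add: v_def algebra_simps)
    also have "\<dots> = A x x - 2 * of_real t * (A x s * cnj (A x s))"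
      by (simp add: h algebra_simps)
    finally show ?thesis by (simp add: N less_eq_complex_def)
  qed
  \<comment> \<open>For \<open>N\<close> nonzero this \<open>t\<close> gives
    \<open>2 * (Re (A x x) + 1) <= Re (A x x)\<close>, against the nonnegative diagonal.\<close>
  from this[of "(Re (A x x) + 1) / N"] have "N = 0"
    by (cases "N = 0") (use psd_on_diag[OF assms(1-3)] in \<open>auto simp: less_eq_complex_def\<close>)
  then show ?thesis by (simp add: N_def sum_power2_eq_zero_iff complex_eq_iff)
qed

text \<open>Cholesky decomposition: each step splits off the rank-one part of one row and column.\<close>

lemma psd_on_gram:
  assumes "finite S" "psd_on S A"
  shows "\<exists>w. \<forall>x\<in>S. \<forall>y\<in>S. A x y = (\<Sum>r\<in>S. w r x * cnj (w r y))"
  using assms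
proof (induction S arbitrary: A)
  case empty
  then show ?case by simp
next
  case (insert s S)
  let ?T = "insert s S"
  have fT: "finite ?T" using insert.hyps by simp
  have herm: "A y x = cnj (A x y)" if "x \<in> ?T" "y \<in> ?T" for x y
    using psd_on_hermitian[OF fT insert.prems that] .
  obtain \<alpha> where \<alpha>: "A s s = of_real \<alpha>" "0 \<le> \<alpha>"
    using psd_on_diag[OF fT insert.prems, of s]
    by (metis complex_eq_iff complex_of_real_def complex.sel Re_complex_of_real Im_complex_of_real
        insertI1 less_eq_complex_def zero_complex.sel)
  have zero: "A x s = 0" if "\<alpha> = 0" "x \<in> ?T" for x
    using psd_on_zero_diag[OF fT insert.prems that(2)] that(1) \<alpha> by simp
  \<comment> \<open>The Schur complement of the entry at \<open>s\<close>. If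
    \<open>A s s = 0\<close>, division by zero makes the correction 0, which is right because the
    whole row and column of \<open>s\<close> vanish then.\<close>
  define A' where "A' = (\<lambda>x y. A x y - A x s * A s y / A s s)"
  have "psd_on S A'"
    unfolding psd_on_def
  proof
    fix v
    define g where "g = (\<Sum>y\<in>S. A s y * v y)"
    \<comment> \<open>The value at \<open>s\<close> that completes the square: with it the form of
      \<open>A\<close> at the extended vector equals the form of \<open>A'\<close> at
      \<open>v\<close>.\<close>
    define c where "c = - g / A s s"
    define v' where "v' = v(s := c)"
    have v's: "v' s = c" and v'S: "\<And>x. x \<in> S \<Longrightarrow> v' x = v x"
      using insert.hyps by (auto simp: v'_def)
    have g': "cnj g = (\<Sum>x\<in>S. cnj (v x) * A x s)"
      using herm[of s] unfolding g_def by (auto intro!: sum.cong simp: mult.commute)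
    have g0: "g = 0" if "\<alpha> = 0"
      unfolding g_def using that zero herm[OF _ insertI1] by (intro sum.neutral) auto
    have inner: "(\<Sum>y\<in>S. A x y * v' y) = (\<Sum>y\<in>S. A x y * v y)" for x
      by (intro sum.cong) (auto simp: v'S)
    have "form ?T A v' v' = cnj c * (A s s * c + g) + (\<Sum>x\<in>S. cnj (v x) * (A x s * c + (\<Sum>y\<in>S. A x y * v y)))"
      unfolding form_alt using insert.hyps
      by (simp add: v's v'S inner g_def)
    also have "\<dots> = cnj c * (A s s * c + g) + cnj g * c + form S A v v"
      unfolding form_alt g' by (simp add: algebra_simps sum.distrib sum_distrib_left sum_distrib_right)
    also have "\<dots> = form S A v v - cnj g * g / A s s"
    proof (cases "\<alpha> = 0")
      case True
      then show ?thesis using g0 \<alpha> by (simp add: c_def)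
    next
      case False
      then show ?thesis using \<alpha> by (simp add: c_def field_simps)
    qed
    also have "\<dots> = form S A' v v"
    proof -
      have "form S A' v v = (\<Sum>x\<in>S. cnj (v x) * ((\<Sum>y\<in>S. A x y * v y) - A x s * g / A s s))"
        unfolding form_alt A'_def g_def
        by (simp add: left_diff_distrib sum_subtractf sum_distrib_left sum_divide_distrib mult.assoc)
      also have "\<dots> = form S A v v - cnj g * g / A s s"
        unfolding form_alt g'
        by (simp add: right_diff_distrib sum_subtractf sum_distrib_right sum_divide_distrib mult.assoc)
      finally show ?thesis by simp
    qed
    finally show "0 \<le> form S A' v v" using insert.prems by (metis psd_on_def)
  qed
  then obtain w where w: "\<And>x y. x \<in> S \<Longrightarrow> y \<in> S \<Longrightarrow> A' x y = (\<Sum>r\<in>S. w r x * cnj (w r y))"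
    using insert.IH by blast
  \<comment> \<open>The vector for \<open>s\<close> is the split-off column, scaled; the vectors for
    \<open>S\<close> are extended by 0 at \<open>s\<close>, since the row and column of
    \<open>s\<close> are already accounted for. For \<alpha> = 0 the division yields the zero
    vector.\<close>
  define w' where "w' = (\<lambda>r x. if r = s then A x s / of_real (sqrt \<alpha>) else if x = s then 0 else w r x)"
  have sq: "of_real (sqrt \<alpha>) * of_real (sqrt \<alpha>) = A s s"
    using \<alpha> by (metis of_real_mult real_sqrt_mult_self abs_of_nonneg)
  have ws: "w' s x * cnj (w' s y) = A x s * A s y / A s s" if "y \<in> ?T" for x y
    using that by (simp add: w'_def sq herm[of y s])
  have "A x y = (\<Sum>r\<in>?T. w' r x * cnj (w' r y))" if xy: "x \<in> ?T" "y \<in> ?T" for x y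
  proof -
    have *: "(\<Sum>r\<in>?T. w' r x * cnj (w' r y)) = A x s * A s y / A s s + (\<Sum>r\<in>S. w' r x * cnj (w' r y))"
      using insert.hyps xy by (simp add: ws)
    show ?thesis
    proof (cases "x = s \<or> y = s")
      case True
      then have "(\<Sum>r\<in>S. w' r x * cnj (w' r y)) = 0"
        using insert.hyps by (intro sum.neutral) (auto simp: w'_def)
      moreover have "A x s * A s y / A s s = A x y"
        using True zero[of x] zero[of y] herm[of y s] herm[of x s] xy \<alpha> by (cases "\<alpha> = 0") auto
      ultimately show ?thesis using * by simp
    next
      case False
      then have "x \<in> S" "y \<in> S" using xy by auto
      moreover have "(\<Sum>r\<in>S. w' r x * cnj (w' r y)) = (\<Sum>r\<in>S. w r x * cnj (w r y))"
        using insert.hyps False by (intro sum.cong) (auto simp: w'_def)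
      ultimately show ?thesis using * w[of x y] by (simp add: A'_def diff_eq_eq add.commute)
    qed
  qed
  then show ?case by blast
qed

lemma gram_form:
  assumes "\<And>x y. x \<in> S \<Longrightarrow> y \<in> S \<Longrightarrow> A x y = (\<Sum>r\<in>R. w r x * cnj (w r y))"
  shows "form S A u v = (\<Sum>r\<in>R. (\<Sum>x\<in>S. cnj (u x) * w r x) * cnj (\<Sum>y\<in>S. cnj (v y) * w r y))"
proof -
  have "form S A u v = form S (\<lambda>x y. \<Sum>r\<in>R. w r x * cnj (w r y)) u v"
    by (rule form_cong) (auto simp: assms)
  also have "\<dots> = (\<Sum>r\<in>R. form S (\<lambda>x y. w r x * cnj (w r y)) u v)" by (rule form_sum)
  also have "\<dots> = (\<Sum>r\<in>R. (\<Sum>x\<in>S. cnj (u x) * w r x) * cnj (\<Sum>y\<in>S. cnj (v y) * w r y))"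
    unfolding form_def cnj_sum sum_product by (intro sum.cong refl) simp
  finally show ?thesis .
qed

text \<open>Gram vectors of \<open>A\<close> turn the trace into a sum of values
  \<open>form S B (w r) (w r)\<close>.\<close>

lemma trace_prod_nonneg:
  assumes "finite S" "psd_on S A" "psd_on S B"
  shows "0 \<le> trace_prod S A B"
proof -
  obtain w where w: "\<And>x y. x \<in> S \<Longrightarrow> y \<in> S \<Longrightarrow> A x y = (\<Sum>r\<in>S. w r x * cnj (w r y))"
    using psd_on_gram[OF assms(1,2)] by blast
  have "trace_prod S A B = (\<Sum>x\<in>S. \<Sum>y\<in>S. \<Sum>r\<in>S. cnj (w r y) * B y x * w r x)"
    unfolding trace_prod_def
    by (intro sum.cong refl) (simp add: w sum_distrib_left sum_distrib_right mult_ac)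
  also have "\<dots> = (\<Sum>r\<in>S. \<Sum>x\<in>S. \<Sum>y\<in>S. cnj (w r y) * B y x * w r x)"
    by (rule sum_rotate)
  also have "\<dots> = (\<Sum>r\<in>S. form S B (w r) (w r))"
    unfolding form_def by (intro sum.cong refl sum.swap)
  finally show ?thesis using assms(3) by (simp add: psd_on_def sum_nonneg)
qed

text \<open>It is enough to decompose \<open>A\<close>: for a rank-one first factor the form at
  \<open>v\<close> is the form of \<open>B\<close> at \<open>v\<close> contracted with that factor's
  vector.\<close>

lemma psd_on_tensor:
  assumes "finite S" "psd_on S A" "psd_on T B"
  shows "psd_on (S \<times> T) (\<lambda>p q. A (fst p) (fst q) * B (snd p) (snd q))"
proof -
  obtain w where w: "\<And>x y. x \<in> S \<Longrightarrow> y \<in> S \<Longrightarrow> A x y = (\<Sum>r\<in>S. w r x * cnj (w r y))"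
    using psd_on_gram[OF assms(1,2)] by blast
  have "psd_on (S \<times> T) (\<lambda>p q. g (fst p) * cnj (g (fst q)) * B (snd p) (snd q))" for g
    unfolding psd_on_def
  proof
    fix v :: "'a \<times> 'b \<Rightarrow> complex"
    define u where "u = (\<lambda>x'. \<Sum>x\<in>S. cnj (g x) * v (x, x'))"
    have "form (S \<times> T) (\<lambda>p q. g (fst p) * cnj (g (fst q)) * B (snd p) (snd q)) v v
       = (\<Sum>x\<in>S. \<Sum>x'\<in>T. \<Sum>y\<in>S. \<Sum>y'\<in>T.
            cnj (v (x, x')) * (g x * cnj (g y)) * B x' y' * v (y, y'))"
      unfolding form_def sum.cartesian_product' by (simp add: mult.assoc)
    also have "\<dots> = (\<Sum>x\<in>S. \<Sum>x'\<in>T. \<Sum>y'\<in>T. \<Sum>y\<in>S.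
            cnj (v (x, x')) * (g x * cnj (g y)) * B x' y' * v (y, y'))"
      by (intro sum.cong refl sum.swap)
    also have "\<dots> = (\<Sum>x'\<in>T. \<Sum>y'\<in>T. \<Sum>x\<in>S. \<Sum>y\<in>S.
            cnj (v (x, x')) * (g x * cnj (g y)) * B x' y' * v (y, y'))"
      by (rule sum_rotate[symmetric])
    also have "\<dots> = form T B u u"
      unfolding form_def u_def
      by (intro sum.cong refl) (simp add: sum_distrib_left sum_distrib_right mult_ac)
    finally show "0 \<le> form (S \<times> T) (\<lambda>p q. g (fst p) * cnj (g (fst q)) * B (snd p) (snd q)) v v"
      using assms(3) by (simp add: psd_on_def)
  qed
  then have "psd_on (S \<times> T) (\<lambda>p q. \<Sum>r\<in>S. w r (fst p) * cnj (w r (fst q)) * B (snd p) (snd q))"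
    by (intro psd_on_sum)
  then show ?thesis
    by (rule psd_on_cong[THEN iffD1, rotated]) (auto simp: w sum_distrib_right)
qed

section \<open>Contractions and the trace norm\<close>

lemma sum_times_delta:
  fixes f :: "'a \<Rightarrow> complex"
  assumes "finite S" "x \<in> S"
  shows "(\<Sum>y\<in>S. f y * (if x = y then 1 else 0)) = f x" "(\<Sum>y\<in>S. f y * (if y = x then 1 else 0)) = f x"
    "(\<Sum>y\<in>S. (if x = y then 1 else 0) * f y) = f x" "(\<Sum>y\<in>S. (if y = x then 1 else 0) * f y) = f x"
proof -
  have "f y * (if x = y then 1 else 0) = (if x = y then f y else 0)"
    "f y * (if y = x then 1 else 0) = (if y = x then f y else 0)"
    "(if x = y then 1 else 0) * f y = (if x = y then f y else 0)"
    "(if y = x then 1 else 0) * f y = (if y = x then f y else 0)" for y by auto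
  then show "(\<Sum>y\<in>S. f y * (if x = y then 1 else 0)) = f x" "(\<Sum>y\<in>S. f y * (if y = x then 1 else 0)) = f x"
    "(\<Sum>y\<in>S. (if x = y then 1 else 0) * f y) = f x" "(\<Sum>y\<in>S. (if y = x then 1 else 0) * f y) = f x"
    using assms by (simp_all only: sum.delta sum.delta' if_True)
qed

text \<open>Reduces statements about \<open>L\<close>-fold tensor products to the two-factor case by
  induction; it serves both positivity and the trace norm.\<close>

lemma bij_betw_PiE_Suc:
  fixes L :: nat
  shows "bij_betw (\<lambda>f. (f L, restrict f {..<L})) ({..<Suc L} \<rightarrow>\<^sub>E S) (S \<times> ({..<L} \<rightarrow>\<^sub>E S))"
proof (rule bij_betw_byWitness[where f' = "\<lambda>(x, f). f(L := x)"])
  show "\<forall>f\<in>{..<Suc L} \<rightarrow>\<^sub>E S. (\<lambda>(x, f). f(L := x)) (f L, restrict f {..<L}) = f"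
  proof
    fix f assume "f \<in> {..<Suc L} \<rightarrow>\<^sub>E S"
    then have "f i = undefined" if "\<not> i < Suc L" for i
      using that by (auto simp: PiE_iff extensional_def)
    then show "(\<lambda>(x, f). f(L := x)) (f L, restrict f {..<L}) = f"
      by (auto simp: restrict_def)
  qed
  show "\<forall>p\<in>S \<times> ({..<L} \<rightarrow>\<^sub>E S). (\<lambda>f. (f L, restrict f {..<L})) ((\<lambda>(x, f). f(L := x)) p) = p"
  proof
    fix p assume "p \<in> S \<times> ({..<L} \<rightarrow>\<^sub>E S)"
    then obtain x f where p: "p = (x, f)" "f \<in> {..<L} \<rightarrow>\<^sub>E S" by blast
    then have "f i = undefined" if "\<not> i < L" for i
      using that by (auto simp: PiE_iff extensional_def)
    then show "(\<lambda>f. (f L, restrict f {..<L})) ((\<lambda>(x, f). f(L := x)) p) = p"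
      by (auto simp: p restrict_def)
  qed
  show "(\<lambda>f. (f L, restrict f {..<L})) ` ({..<Suc L} \<rightarrow>\<^sub>E S) \<subseteq> S \<times> ({..<L} \<rightarrow>\<^sub>E S)"
    by (intro image_subsetI SigmaI restrict_PiE_iff[THEN iffD2]) (simp_all add: PiE_iff)
  show "(\<lambda>(x, f). f(L := x)) ` (S \<times> ({..<L} \<rightarrow>\<^sub>E S)) \<subseteq> {..<Suc L} \<rightarrow>\<^sub>E S"
    unfolding lessThan_Suc PiE_insert_eq by auto
qed

lemma psd_on_PiE:
  fixes L :: nat
  assumes "finite S" "\<And>l. l < L \<Longrightarrow> psd_on S (A l)"
  shows "psd_on ({..<L} \<rightarrow>\<^sub>E S) (\<lambda>f g. \<Prod>l<L. A l (f l) (g l))"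
  using assms(2)
proof (induction L)
  case 0
  then show ?case by (simp add: psd_on_def form_def less_eq_complex_def)
next
  case (Suc L)
  have "psd_on (S \<times> ({..<L} \<rightarrow>\<^sub>E S)) (\<lambda>p q. A L (fst p) (fst q) * (\<Prod>l<L. A l (snd p l) (snd q l)))"
    using Suc by (intro psd_on_tensor assms(1)) auto
  from psd_on_bij[OF bij_betw_PiE_Suc this] show ?case by (simp add: mult.commute)
qed

abbreviation l2norm :: "'a set \<Rightarrow> ('a \<Rightarrow> complex) \<Rightarrow> real" where
  "l2norm S u \<equiv> L2_set (\<lambda>x. cmod (u x)) S"

text \<open>Operator norm at most \<open>c\<close>. The sesquilinear form of the bound lets one
  insert product vectors and read off bounds for parts of an operator on a product.\<close>

definition contraction :: "'a set \<Rightarrow> real \<Rightarrow> ('a \<Rightarrow> 'a \<Rightarrow> complex) \<Rightarrow> bool" where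
  "contraction S c W \<longleftrightarrow> (\<forall>u v. cmod (form S W u v) \<le> c * l2norm S u * l2norm S v)"

text \<open>The trace norm as the dual of the operator norm.\<close>

definition trace_norm_le :: "'a set \<Rightarrow> ('a \<Rightarrow> 'a \<Rightarrow> complex) \<Rightarrow> real \<Rightarrow> bool" where
  "trace_norm_le S Y t \<longleftrightarrow> (\<forall>U. contraction S 1 U \<longrightarrow> cmod (trace_prod S U Y) \<le> t)"

lemma l2norm_square: "complex_of_real ((l2norm S u)\<^sup>2) = (\<Sum>x\<in>S. u x * cnj (u x))"
  by (simp add: L2_set_def sum_nonneg complex_norm_square[symmetric])

lemma form_id:
  assumes "finite S"
  shows "form S (\<lambda>x y. if x = y then 1 else 0) u u = of_real ((l2norm S u)\<^sup>2)"
  unfolding form_alt l2norm_square using assms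
  by (intro sum.cong refl) (simp add: sum_times_delta)

lemma form_diff: "form S (\<lambda>x y. A x y - B x y) u v = form S A u v - form S B u v"
  by (simp add: form_def algebra_simps sum_subtractf)

lemma form_add: "form S (\<lambda>x y. A x y + B x y) u v = form S A u v + form S B u v"
  by (simp add: form_def algebra_simps sum.distrib)

lemma form_scale: "form S (\<lambda>x y. c * A x y) u v = c * form S A u v"
  by (simp add: form_def sum_distrib_left mult_ac)

lemma form_adjoint: "form S (\<lambda>x y. cnj (A y x)) u v = cnj (form S A v u)"
proof -
  have "form S (\<lambda>x y. cnj (A y x)) u v = (\<Sum>y\<in>S. \<Sum>x\<in>S. cnj (u x) * cnj (A y x) * v y)"
    unfolding form_def by (rule sum.swap)
  then show ?thesis by (simp add: form_def mult_ac)
qed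

text \<open>Writing \<open>N\<close> by Gram vectors, the squared norm of \<alpha> \<open>u\<close>
  is the form of \<open>N\<close> at \<open>u\<close>, hence at most that of the identity.
  Cauchy-Schwarz for \<alpha> \<open>u\<close> and \<alpha> \<open>v\<close> then bounds the
  off-diagonal values.\<close>

lemma contraction_of_psd:
  assumes "finite S" "psd_on S N" "psd_on S (\<lambda>x y. (if x = y then 1 else 0) - N x y)"
  shows "contraction S 1 N"
  unfolding contraction_def
proof (intro allI)
  fix u v
  obtain w where w: "\<And>x y. x \<in> S \<Longrightarrow> y \<in> S \<Longrightarrow> N x y = (\<Sum>r\<in>S. w r x * cnj (w r y))"
    using psd_on_gram[OF assms(1,2)] by blast
  define \<alpha> where "\<alpha> = (\<lambda>u r. \<Sum>x\<in>S. cnj (u x) * w r x)"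
  have gram: "form S N u v = (\<Sum>r\<in>S. \<alpha> u r * cnj (\<alpha> v r))" for u v
    unfolding \<alpha>_def by (rule gram_form[OF w])
  have le: "l2norm S (\<alpha> u) \<le> l2norm S u" for u
  proof -
    have "0 \<le> form S (\<lambda>x y. (if x = y then 1 else 0) - N x y) u u"
      using assms(3) unfolding psd_on_def by blast
    also have "\<dots> = of_real ((l2norm S u)\<^sup>2) - of_real ((l2norm S (\<alpha> u))\<^sup>2)"
      unfolding form_diff form_id[OF assms(1)] gram l2norm_square[of "\<alpha> u"] ..
    finally have "(l2norm S (\<alpha> u))\<^sup>2 \<le> (l2norm S u)\<^sup>2"
      by (simp add: less_eq_complex_def)
    then show ?thesis by (rule power2_le_imp_le) (simp add: L2_set_nonneg)
  qed
  have "cmod (form S N u v) = cmod (\<Sum>r\<in>S. \<alpha> u r * cnj (\<alpha> v r))"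
    by (simp only: gram)
  also have "\<dots> \<le> (\<Sum>r\<in>S. \<bar>cmod (\<alpha> u r)\<bar> * \<bar>cmod (\<alpha> v r)\<bar>)"
    by (rule order_trans[OF norm_sum]) (simp add: norm_mult)
  also have "\<dots> \<le> l2norm S (\<alpha> u) * l2norm S (\<alpha> v)" by (rule L2_set_mult_ineq)
  also have "\<dots> \<le> l2norm S u * l2norm S v"
    by (intro mult_mono le L2_set_nonneg)
  finally show "cmod (form S N u v) \<le> 1 * l2norm S u * l2norm S v" by simp
qed

lemma contraction_bij:
  assumes "bij_betw h T S" "contraction S c W"
  shows "contraction T c (\<lambda>x y. W (h x) (h y))"
  unfolding contraction_def
proof (intro allI)
  fix u v
  have n: "l2norm S (\<lambda>z. u (inv_into T h z)) = l2norm T u" for u :: "_ \<Rightarrow> complex"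
  proof -
    have "(\<Sum>z\<in>S. (cmod (u (inv_into T h z)))\<^sup>2) = (\<Sum>x\<in>T. (cmod (u (inv_into T h (h x))))\<^sup>2)"
      by (rule sum.reindex_bij_betw[OF assms(1), symmetric])
    also have "\<dots> = (\<Sum>x\<in>T. (cmod (u x))\<^sup>2)"
      using assms(1) by (intro sum.cong) (auto simp: bij_betw_def)
    finally show ?thesis by (simp add: L2_set_def)
  qed
  show "cmod (form T (\<lambda>x y. W (h x) (h y)) u v) \<le> c * l2norm T u * l2norm T v"
    using assms(2) unfolding form_bij'[OF assms(1)] contraction_def n[of u, symmetric] n[of v, symmetric]
    by blast
qed

lemma contraction_entry:
  assumes "finite S" "contraction S c W" "x \<in> S" "y \<in> S"
  shows "cmod (W x y) \<le> c"
proof -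
  have "l2norm S (\<lambda>z. if z = x then 1 else 0) = 1" if "x \<in> S" for x
    using that assms(1) by (simp add: L2_set_def if_distrib[of cmod] if_distrib[of "\<lambda>x. x\<^sup>2"] cong: if_cong)
  moreover have "cmod (form S W (\<lambda>z. if z = x then 1 else 0) (\<lambda>z. if z = y then 1 else 0))
      \<le> c * l2norm S (\<lambda>z. if z = x then 1 else 0) * l2norm S (\<lambda>z. if z = y then 1 else 0)"
    using assms(2) unfolding contraction_def by blast
  ultimately show ?thesis
    using assms(3,4) by (simp add: form_single[OF assms(1,3,4)])
qed

lemma contraction_scale:
  assumes "contraction S c W"
  shows "contraction S (cmod a * c) (\<lambda>x y. a * W x y)"
  unfolding contraction_def form_scale norm_mult mult.assoc
  using assms[unfolded contraction_def mult.assoc] by (intro allI mult_left_mono) auto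

lemma trace_prod_scale: "trace_prod S (\<lambda>x y. c * A x y) B = c * trace_prod S A B"
  by (simp add: trace_prod_def sum_distrib_left mult_ac)

lemma trace_norm_le_scaled:
  assumes "finite S" "trace_norm_le S Y t" "contraction S c U" "0 \<le> c"
  shows "cmod (trace_prod S U Y) \<le> c * t"
proof (cases "c = 0")
  case True
  \<comment> \<open>Rescaling by \<open>1 / c\<close> is impossible here, but every entry of
    \<open>U\<close> is bounded by 0.\<close>
  then have "trace_prod S U Y = 0"
    using contraction_entry[OF assms(1,3)] by (simp add: trace_prod_def)
  then show ?thesis using True by simp
next
  case False
  have "contraction S 1 (\<lambda>x y. of_real (1 / c) * U x y)"
    using contraction_scale[OF assms(3), of "of_real (1 / c)"] False assms(4)
    by (simp add: norm_divide)
  then have "cmod (of_real (1 / c) * trace_prod S U Y) \<le> t"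
    using assms(2) unfolding trace_norm_le_def trace_prod_scale[symmetric] by blast
  then show ?thesis using False assms(4) by (simp add: norm_mult norm_divide field_simps)
qed

text \<open>Test with \<open>U = 0\<close>. In the final theorem this supplies
  \<open>0 <= n * q_G - 1\<close>.\<close>

lemma trace_norm_le_nonneg:
  assumes "trace_norm_le S Y t"
  shows "0 \<le> t"
proof -
  have "contraction S 1 (\<lambda>_ _. 0)"
    by (simp add: contraction_def form_def L2_set_nonneg)
  then have "cmod (trace_prod S (\<lambda>_ _. 0) Y) \<le> t"
    using assms unfolding trace_norm_le_def by blast
  then show ?thesis by (simp add: trace_prod_def)
qed

lemma l2norm_product:
  "l2norm (S \<times> T) (\<lambda>p. u (fst p) * u' (snd p)) = l2norm S u * l2norm T u'"
  unfolding L2_set_def real_sqrt_mult[symmetric] sum_product sum.cartesian_product'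
  by (simp add: norm_mult power_mult_distrib)

text \<open>Contracting \<open>W\<close> with \<open>Y2\<close> over the second factor leaves an operator of norm at most \<open>t2\<close>,
  because its matrix elements are themselves traces of \<open>Y2\<close> against partial matrix elements of \<open>W\<close>.\<close>

lemma trace_norm_le_tensor:
  assumes fin: "finite S" "finite T" and Y: "trace_norm_le S Y1 t1" "trace_norm_le T Y2 t2"
  shows "trace_norm_le (S \<times> T) (\<lambda>p q. Y1 (fst p) (fst q) * Y2 (snd p) (snd q)) (t1 * t2)"
  unfolding trace_norm_le_def
proof (intro allI impI)
  fix W :: "'a \<times> 'b \<Rightarrow> 'a \<times> 'b \<Rightarrow> complex"
  assume W: "contraction (S \<times> T) 1 W"
  define V where "V = (\<lambda>x y. \<Sum>x'\<in>T. \<Sum>y'\<in>T. W (x, x') (y, y') * Y2 y' x')"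
  have "contraction S t2 V"
    unfolding contraction_def
  proof (intro allI)
    fix a b
    \<comment> \<open>Fixing \<open>a\<close> and \<open>b\<close> on the first factor leaves an
      operator on the second. Norms of product vectors multiply, so its norm is at most the product
      of the norms of \<open>a\<close> and \<open>b\<close>.\<close>
    define G where "G = (\<lambda>x' y'. form S (\<lambda>x y. W (x, x') (y, y')) a b)"
    have fG: "form T G a' b' = form (S \<times> T) W (\<lambda>p. a (fst p) * a' (snd p)) (\<lambda>p. b (fst p) * b' (snd p))" for a' b'
    proof -
      have "form T G a' b' = (\<Sum>x'\<in>T. \<Sum>y'\<in>T. \<Sum>x\<in>S. \<Sum>y\<in>S.
          cnj (a x * a' x') * W (x, x') (y, y') * (b y * b' y'))"
        unfolding form_def G_def
        by (intro sum.cong refl) (simp add: sum_distrib_left sum_distrib_right mult_ac)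
      also have "\<dots> = (\<Sum>x\<in>S. \<Sum>x'\<in>T. \<Sum>y'\<in>T. \<Sum>y\<in>S.
          cnj (a x * a' x') * W (x, x') (y, y') * (b y * b' y'))"
        by (rule sum_rotate)
      also have "\<dots> = (\<Sum>x\<in>S. \<Sum>x'\<in>T. \<Sum>y\<in>S. \<Sum>y'\<in>T.
          cnj (a x * a' x') * W (x, x') (y, y') * (b y * b' y'))"
        by (intro sum.cong refl sum.swap)
      finally show ?thesis unfolding form_def sum.cartesian_product' by simp
    qed
    have "contraction T (l2norm S a * l2norm S b) G"
      unfolding contraction_def
    proof (intro allI)
      fix a' b'
      have "cmod (form T G a' b') \<le> 1 * (l2norm S a * l2norm T a') * (l2norm S b * l2norm T b')"
        using W unfolding fG contraction_def l2norm_product[symmetric] by blast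
      then show "cmod (form T G a' b') \<le> l2norm S a * l2norm S b * l2norm T a' * l2norm T b'"
        by (simp add: mult_ac)
    qed
    then have "cmod (trace_prod T G Y2) \<le> l2norm S a * l2norm S b * t2"
      by (intro trace_norm_le_scaled fin Y mult_nonneg_nonneg L2_set_nonneg)
    moreover have "trace_prod T G Y2 = form S V a b"
    proof -
      have "trace_prod T G Y2 = (\<Sum>x'\<in>T. \<Sum>y'\<in>T. \<Sum>x\<in>S. \<Sum>y\<in>S. cnj (a x) * (W (x, x') (y, y') * Y2 y' x') * b y)"
        unfolding trace_prod_def G_def form_def
        by (intro sum.cong refl) (simp add: sum_distrib_left sum_distrib_right mult_ac)
      also have "\<dots> = (\<Sum>x\<in>S. \<Sum>x'\<in>T. \<Sum>y'\<in>T. \<Sum>y\<in>S. cnj (a x) * (W (x, x') (y, y') * Y2 y' x') * b y)"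
        by (rule sum_rotate)
      also have "\<dots> = (\<Sum>x\<in>S. \<Sum>y\<in>S. \<Sum>x'\<in>T. \<Sum>y'\<in>T. cnj (a x) * (W (x, x') (y, y') * Y2 y' x') * b y)"
        by (intro sum.cong refl sum_rotate)
      also have "\<dots> = form S V a b"
        unfolding form_def V_def by (simp add: sum_distrib_left sum_distrib_right)
      finally show ?thesis .
    qed
    ultimately show "cmod (form S V a b) \<le> t2 * l2norm S a * l2norm S b"
      by (simp add: mult_ac)
  qed
  then have "cmod (trace_prod S V Y1) \<le> t2 * t1"
    by (intro trace_norm_le_scaled fin Y trace_norm_le_nonneg[OF Y(2)])
  moreover have "trace_prod (S \<times> T) W (\<lambda>p q. Y1 (fst p) (fst q) * Y2 (snd p) (snd q)) = trace_prod S V Y1"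
  proof -
    have "trace_prod (S \<times> T) W (\<lambda>p q. Y1 (fst p) (fst q) * Y2 (snd p) (snd q))
        = (\<Sum>x\<in>S. \<Sum>x'\<in>T. \<Sum>y\<in>S. \<Sum>y'\<in>T. W (x, x') (y, y') * Y2 y' x' * Y1 y x)"
      unfolding trace_prod_def sum.cartesian_product' by (simp add: mult_ac)
    also have "\<dots> = (\<Sum>x\<in>S. \<Sum>y\<in>S. \<Sum>x'\<in>T. \<Sum>y'\<in>T. W (x, x') (y, y') * Y2 y' x' * Y1 y x)"
      by (intro sum.cong refl sum.swap)
    also have "\<dots> = trace_prod S V Y1"
      unfolding trace_prod_def V_def by (simp add: sum_distrib_right)
    finally show ?thesis .
  qed
  ultimately show "cmod (trace_prod (S \<times> T) W (\<lambda>p q. Y1 (fst p) (fst q) * Y2 (snd p) (snd q))) \<le> t1 * t2"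
    by (simp add: mult.commute)
qed

lemma trace_prod_bij:
  assumes "bij_betw h T S"
  shows "trace_prod T (\<lambda>x y. A (h x) (h y)) (\<lambda>x y. B (h x) (h y)) = trace_prod S A B"
proof -
  have "trace_prod T (\<lambda>x y. A (h x) (h y)) (\<lambda>x y. B (h x) (h y))
      = (\<Sum>x\<in>T. \<Sum>y\<in>S. A (h x) y * B y (h x))"
    unfolding trace_prod_def
    by (intro sum.cong refl
        sum.reindex_bij_betw[OF assms, where g = "\<lambda>y. A (h x) y * B y (h x)" for x])
  also have "\<dots> = trace_prod S A B"
    unfolding trace_prod_def
    by (rule sum.reindex_bij_betw[OF assms, where g = "\<lambda>x. \<Sum>y\<in>S. A x y * B y x"])
  finally show ?thesis .
qed

lemma trace_prod_cong:
  assumes "\<And>x y. x \<in> S \<Longrightarrow> y \<in> S \<Longrightarrow> A x y = A' x y" "\<And>x y. x \<in> S \<Longrightarrow> y \<in> S \<Longrightarrow> B x y = B' x y"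
  shows "trace_prod S A B = trace_prod S A' B'"
  unfolding trace_prod_def using assms by (intro sum.cong refl) auto

lemma trace_norm_le_bij:
  assumes h: "bij_betw h T S" and Y: "trace_norm_le S Y t"
  shows "trace_norm_le T (\<lambda>x y. Y (h x) (h y)) t"
  unfolding trace_norm_le_def
proof (intro allI impI)
  fix U assume U: "contraction T 1 U"
  let ?g = "inv_into T h"
  have "contraction S 1 (\<lambda>x y. U (?g x) (?g y))"
    by (rule contraction_bij[OF bij_betw_inv_into[OF h] U])
  then have "cmod (trace_prod S (\<lambda>x y. U (?g x) (?g y)) Y) \<le> t"
    using Y unfolding trace_norm_le_def by blast
  moreover have "trace_prod S (\<lambda>x y. U (?g x) (?g y)) Y
      = trace_prod T (\<lambda>x y. U (?g (h x)) (?g (h y))) (\<lambda>x y. Y (h x) (h y))"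
    by (rule trace_prod_bij[OF h, symmetric])
  moreover have "\<dots> = trace_prod T U (\<lambda>x y. Y (h x) (h y))"
    using h by (intro trace_prod_cong) (auto simp: bij_betw_def)
  ultimately show "cmod (trace_prod T U (\<lambda>x y. Y (h x) (h y))) \<le> t" by simp
qed

lemma trace_norm_le_PiE:
  fixes L :: nat
  assumes "finite S" "trace_norm_le S Y t"
  shows "trace_norm_le ({..<L} \<rightarrow>\<^sub>E S) (\<lambda>f g. \<Prod>l<L. Y (f l) (g l)) (t ^ L)"
proof (induction L)
  case 0
  \<comment> \<open>With no factors the index set is a single function and the tensor power is the
    scalar 1, so the trace is the one entry of \<open>U\<close>.\<close>
  have "cmod (U (\<lambda>_. undefined) (\<lambda>_. undefined)) \<le> 1" if "contraction {\<lambda>_. undefined} 1 U"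
    for U :: "(nat \<Rightarrow> 'a) \<Rightarrow> (nat \<Rightarrow> 'a) \<Rightarrow> complex"
    by (rule contraction_entry[OF _ that]) simp_all
  then show ?case
    by (simp add: trace_norm_le_def trace_prod_def)
next
  case (Suc L)
  have "trace_norm_le (S \<times> ({..<L} \<rightarrow>\<^sub>E S)) (\<lambda>p q. Y (fst p) (fst q) * (\<Prod>l<L. Y (snd p l) (snd q l))) (t * t ^ L)"
    using Suc assms by (intro trace_norm_le_tensor finite_PiE) auto
  from trace_norm_le_bij[OF bij_betw_PiE_Suc this] show ?case by (simp add: mult.commute)
qed

section \<open>Measurements and Fourier analysis modulo n\<close>

text \<open>The counterpart of \<open>measurement\<close> on an arbitrary index set, so that a
  measurement on \<open>L\<close> copies can be moved to functions on the positions.\<close>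

definition povm :: "'a set \<Rightarrow> nat \<Rightarrow> (nat \<Rightarrow> 'a \<Rightarrow> 'a \<Rightarrow> complex) \<Rightarrow> bool" where
  "povm S n N \<longleftrightarrow> (\<forall>i<n. psd_on S (N i)) \<and>
     (\<forall>x\<in>S. \<forall>y\<in>S. (\<Sum>i<n. N i x y) = (if x = y then 1 else 0))"

lemma povm_bij:
  assumes h: "bij_betw h T S" and N: "povm S n N"
  shows "povm T n (\<lambda>i x y. N i (h x) (h y))"
proof -
  have "h x \<in> S" "h x = h y \<longleftrightarrow> x = y" if "x \<in> T" "y \<in> T" for x y
    using h that by (auto simp: bij_betw_def inj_on_eq_iff)
  then show ?thesis
    using N psd_on_bij[OF h] by (auto simp: povm_def)
qed

text \<open>The identity minus one element is the sum of the other elements, hence positive.\<close>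

lemma povm_contraction:
  assumes "finite S" "povm S n N" "i < n"
  shows "contraction S 1 (N i)"
proof (rule contraction_of_psd)
  show "psd_on S (N i)" using assms by (simp add: povm_def)
  have "psd_on S (\<lambda>x y. \<Sum>j\<in>{..<n} - {i}. N j x y)"
    using assms by (intro psd_on_sum) (auto simp: povm_def)
  then show "psd_on S (\<lambda>x y. (if x = y then 1 else 0) - N i x y)"
  proof (rule psd_on_cong[THEN iffD1, rotated])
    fix x y assume "x \<in> S" "y \<in> S"
    then have "(if x = y then 1 else 0) = (\<Sum>j<n. N j x y)"
      using assms(2) by (simp add: povm_def)
    also have "\<dots> = N i x y + (\<Sum>j\<in>{..<n} - {i}. N j x y)"
      using assms(3) by (intro sum.remove) auto
    finally show "(\<Sum>j\<in>{..<n} - {i}. N j x y) = (if x = y then 1 else 0) - N i x y"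
      by (simp add: algebra_simps)
  qed
qed (fact assms(1))

lemma trace_prod_commute: "trace_prod S A B = trace_prod S B A"
proof -
  have "trace_prod S A B = (\<Sum>y\<in>S. \<Sum>x\<in>S. A x y * B y x)"
    unfolding trace_prod_def by (rule sum.swap)
  then show ?thesis by (simp add: trace_prod_def mult.commute)
qed

lemma trace_prod_sum: "trace_prod S (\<lambda>x y. \<Sum>i\<in>I. A i x y) B = (\<Sum>i\<in>I. trace_prod S (A i) B)"
proof -
  have "trace_prod S (\<lambda>x y. \<Sum>i\<in>I. A i x y) B = (\<Sum>x\<in>S. \<Sum>y\<in>S. \<Sum>i\<in>I. A i x y * B y x)"
    by (simp add: trace_prod_def sum_distrib_right)
  also have "\<dots> = (\<Sum>i\<in>I. trace_prod S (A i) B)"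
    unfolding trace_prod_def by (rule sum_rotate)
  finally show ?thesis .
qed

lemma trace_prod_add: "trace_prod S (\<lambda>x y. A x y + A' x y) B = trace_prod S A B + trace_prod S A' B"
  by (simp add: trace_prod_def algebra_simps sum.distrib)

lemma trace_prod_id:
  assumes "finite S" "\<And>x y. x \<in> S \<Longrightarrow> y \<in> S \<Longrightarrow> B x y = (if x = y then 1 else 0)"
  shows "trace_prod S A B = (\<Sum>x\<in>S. A x x)"
proof -
  have "trace_prod S A B = (\<Sum>x\<in>S. \<Sum>y\<in>S. A x y * (if y = x then 1 else 0))"
    unfolding trace_prod_def using assms(2) by (intro sum.cong refl) auto
  then show ?thesis using assms(1) by (simp only: sum_times_delta cong: sum.cong)
qed

lemma trace_prod_adjoint:
  assumes "\<And>x y. x \<in> S \<Longrightarrow> y \<in> S \<Longrightarrow> X y x = cnj (X x y)"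
  shows "trace_prod S (\<lambda>x y. cnj (U y x)) X = cnj (trace_prod S U X)"
proof -
  have "trace_prod S (\<lambda>x y. cnj (U y x)) X = (\<Sum>y\<in>S. \<Sum>x\<in>S. cnj (U y x) * X y x)"
    unfolding trace_prod_def by (rule sum.swap)
  also have "\<dots> = cnj (trace_prod S U X)"
    unfolding trace_prod_def cnj_sum by (intro sum.cong refl) (simp add: assms[symmetric])
  finally show ?thesis .
qed

lemma sum_root_unity:
  fixes z :: complex
  assumes "z ^ n = 1" "z \<noteq> 1"
  shows "(\<Sum>i<n. z ^ i) = 0"
  using assms by (simp add: geometric_sum)

text \<open>Given a contraction \<open>U\<close>, the operators
  \<open>(1/n) (1 + (z^i U + (z^i U)\<^sup>*) / 2)\<close> form a measurement, since the powers of \<open>z\<close> sum to zero.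
  Choosing the phase of \<open>U\<close>, its success is \<open>(1/n) (1 + |Tr (U Y)|)\<close> with \<open>Y = \<Sum>i. z^i X i\<close>.\<close>

lemma trace_norm_le_of_success:
  assumes S: "finite S" and n: "0 < n"
    and herm: "\<And>i x y. i < n \<Longrightarrow> x \<in> S \<Longrightarrow> y \<in> S \<Longrightarrow> X i y x = cnj (X i x y)"
    and tr: "(\<Sum>i<n. \<Sum>x\<in>S. X i x x) = 1"
    and q: "\<And>N. povm S n N \<Longrightarrow> (\<Sum>i<n. Re (trace_prod S (N i) (X i))) \<le> q"
    and z: "z ^ n = 1" "z \<noteq> 1" "cmod z = 1"
  shows "trace_norm_le S (\<lambda>x y. \<Sum>i<n. z ^ i * X i x y) (real n * q - 1)"
  unfolding trace_norm_le_def
proof (intro allI impI)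
  fix U0 assume U0: "contraction S 1 U0"
  define Y where "Y = (\<lambda>x y. \<Sum>i<n. z ^ i * X i x y)"
  define T where "T = trace_prod S U0 Y"
  \<comment> \<open>The phase that makes the trace equal to its modulus. The value 1 for
    \<open>T = 0\<close> keeps \<open>cmod e = 1\<close>.\<close>
  define e where "e = (if T = 0 then 1 else cnj T / of_real (cmod T))"
  have e: "cmod e = 1" by (simp add: e_def norm_divide)
  have eT: "e * T = of_real (cmod T)"
    by (cases "T = 0") (simp_all add: e_def field_simps complex_norm_square[symmetric] power2_eq_square)
  define U where "U = (\<lambda>x y. e * U0 x y)"
  have U: "contraction S 1 U"
    using contraction_scale[OF U0, of e] e by (simp add: U_def)
  have UY: "trace_prod S U Y = of_real (cmod T)"
    by (simp add: U_def trace_prod_scale T_def[symmetric] eT)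
  define V where "V = (\<lambda>i x y. z ^ i * U x y)"
  define N where "N = (\<lambda>i x y. of_real (1 / n) * ((if x = y then 1 else 0) + 1/2 * (V i x y + cnj (V i y x))))"
  have z0: "(\<Sum>i<n. z ^ i) = 0" by (rule sum_root_unity[OF z(1,2)])
  have "povm S n N"
    unfolding povm_def
  proof (intro conjI allI impI ballI)
    fix i assume "i < n"
    show "psd_on S (N i)"
      unfolding psd_on_def
    proof
      fix v
      have "contraction S 1 (V i)"
        using contraction_scale[OF U, of "z ^ i"] z(3) by (simp add: V_def norm_power)
      \<comment> \<open>The identity thus outweighs the real part of \<open>V i\<close> in
        \<open>N i\<close>, whatever its sign; this is where the contraction property yields
        positivity.\<close>
      then have b: "cmod (form S (V i) v v) \<le> (l2norm S v)\<^sup>2"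
        by (simp add: contraction_def power2_eq_square)
      have "form S (N i) v v = of_real (1 / n) * (of_real ((l2norm S v)\<^sup>2) + 1/2 * (form S (V i) v v + cnj (form S (V i) v v)))"
        unfolding N_def form_scale form_add form_id[OF S] form_adjoint ..
      also have "\<dots> = of_real (1 / n * ((l2norm S v)\<^sup>2 + Re (form S (V i) v v)))"
        by (simp add: complex_eq_iff)
      finally show "0 \<le> form S (N i) v v"
        using abs_Re_le_cmod[of "form S (V i) v v"] b by (simp add: less_eq_complex_def)
    qed
  next
    fix x y assume "x \<in> S" "y \<in> S"
    have "(\<Sum>i<n. V i x y) = 0" for x y
      by (simp add: V_def sum_distrib_right[symmetric] z0)
    then have "(\<Sum>i<n. V i x y + cnj (V i y x)) = 0"
      by (simp add: sum.distrib cnj_sum[symmetric] del: cnj_sum)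
    then show "(\<Sum>i<n. N i x y) = (if x = y then 1 else 0)"
      using n by (simp add: N_def sum_distrib_left[symmetric] sum.distrib sum_divide_distrib[symmetric])
  qed
  then have "(\<Sum>i<n. Re (trace_prod S (N i) (X i))) \<le> q" by (rule q)
  moreover have "Re (trace_prod S (N i) (X i)) = 1 / n * (Re (\<Sum>x\<in>S. X i x x) + Re (trace_prod S (V i) (X i)))"
    if "i < n" for i
  proof -
    have "trace_prod S (N i) (X i) = of_real (1 / n) * (trace_prod S (\<lambda>x y. if x = y then 1 else 0) (X i) +
        1/2 * (trace_prod S (V i) (X i) + cnj (trace_prod S (V i) (X i))))"
      unfolding N_def trace_prod_scale trace_prod_add using trace_prod_adjoint[OF herm[OF that], where U = "V i"]
      by simp
    also have "trace_prod S (\<lambda>x y. if x = y then 1 else 0) (X i) = (\<Sum>x\<in>S. X i x x)"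
      using trace_prod_id[OF S, of "\<lambda>x y. if x = y then 1 else 0" "X i"] by (simp add: trace_prod_commute)
    finally show ?thesis by simp
  qed
  moreover have "(\<Sum>i<n. Re (trace_prod S (V i) (X i))) = cmod T"
  proof -
    have "(\<Sum>i<n. trace_prod S (V i) (X i)) = trace_prod S U Y"
      unfolding Y_def trace_prod_commute[of S U] trace_prod_sum V_def
      by (intro sum.cong refl) (simp add: trace_prod_scale trace_prod_commute[of S U])
    then show ?thesis unfolding UY Re_sum[symmetric] by simp
  qed
  moreover have "(\<Sum>i<n. Re (\<Sum>x\<in>S. X i x x)) = 1"
    unfolding Re_sum[symmetric] tr by simp
  ultimately have "1 / n * (1 + cmod T) \<le> q"
    by (simp add: sum_distrib_left[symmetric] sum.distrib sum_divide_distrib[symmetric])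
  then show "cmod (trace_prod S U0 (\<lambda>x y. \<Sum>i<n. z ^ i * X i x y)) \<le> real n * q - 1"
    using n unfolding Y_def[symmetric] T_def[symmetric] by (simp add: field_simps)
qed

section \<open>Strings modulo \<open>n\<close> and their Fourier expansion\<close>

lemma finite_strings [simp]: "finite (strings n L i)"
  unfolding strings_def by (simp add: finite_PiE)

lemma sum_strings:
  assumes "0 < n"
  shows "(\<Sum>i<n. \<Sum>c\<in>strings n L i. F c) = (\<Sum>c\<in>{..<L} \<rightarrow>\<^sub>E {..<n}. F c)"
proof -
  have "(\<Sum>i<n. \<Sum>c\<in>strings n L i. F c) = (\<Sum>c\<in>(\<Union>i<n. strings n L i). F c)"
    by (rule sum.UNION_disjoint[symmetric]) (simp_all, auto simp: strings_def)
  also have "(\<Union>i<n. strings n L i) = {..<L} \<rightarrow>\<^sub>E {..<n}"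
    using assms by (auto simp: strings_def)
  finally show ?thesis .
qed

text \<open>Orthogonality of the characters of the integers modulo \<open>n\<close>: the summand is
  the \<open>k\<close>-th power of one \<open>n\<close>-th root of unity, which equals 1 exactly
  when \<open>s\<close> is congruent to \<open>i\<close>. Injectivity of the powers below
  \<open>n\<close> says that \<open>w\<close> is primitive.\<close>

lemma root_unity_indicator:
  fixes w :: complex
  assumes n: "0 < n" and w: "w ^ n = 1" "cmod w = 1" "inj_on (\<lambda>k. w ^ k) {..<n}" and "i < n"
  shows "(\<Sum>k<n. cnj (w ^ i) ^ k * (w ^ s) ^ k) = (if s mod n = i then of_nat n else 0)"
proof -
  have mod: "w ^ s = w ^ (s mod n)"
  proof -
    have "w ^ s = w ^ (n * (s div n) + s mod n)" by simp
    also have "\<dots> = w ^ (s mod n)" by (simp only: power_add power_mult w(1)) simp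
    finally show ?thesis .
  qed
  have cw: "cnj (w ^ i) * w ^ i = 1"
    using w(2) by (simp add: complex_norm_square[symmetric] mult.commute power_mult_distrib[symmetric])
  define z where "z = cnj (w ^ i) * w ^ s"
  have "z ^ n = cnj ((w ^ n) ^ i) * (w ^ n) ^ s"
    by (simp add: z_def power_mult_distrib power_mult[symmetric] mult.commute)
  then have zn: "z ^ n = 1" using w(1) by simp
  have "z = 1 \<longleftrightarrow> s mod n = i"
  proof
    assume "z = 1"
    have "w ^ s = cnj (w ^ i) * w ^ i * w ^ s" unfolding cw by (rule mult_1_left[symmetric])
    also have "\<dots> = w ^ i * z" by (simp only: z_def mult_ac)
    finally have "w ^ (s mod n) = w ^ i" using \<open>z = 1\<close> by (simp only: mod mult_1_right)
    then show "s mod n = i"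
      by (rule inj_onD[OF w(3)]) (use n \<open>i < n\<close> in auto)
  next
    assume "s mod n = i"
    then show "z = 1" unfolding z_def mod by (simp only: cw)
  qed
  moreover have "(\<Sum>k<n. z ^ k) = (if z = 1 then of_nat n else 0)"
    using sum_root_unity[OF zn] by auto
  ultimately show ?thesis by (simp add: z_def power_mult_distrib)
qed

text \<open>The constraint on the sum of a string couples all positions. Replacing it by an average
  over characters decouples them, since \<open>w ^ (k * sum)\<close> is a product over positions;
  the free sum over strings then becomes a product of sums.\<close>

lemma Pi_strings_fourier:
  assumes n: "0 < n" and w: "w ^ n = 1" "cmod w = 1" "inj_on (\<lambda>k. w ^ k) {..<n}" and i: "i < n"
  shows "(\<Sum>c\<in>strings n L i. \<Prod>l<L. a l (c l))
    = of_real (1 / n) * (\<Sum>k<n. cnj (w ^ i) ^ k * (\<Prod>l<L. \<Sum>j<n. (w ^ k) ^ j * a l j))"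
proof -
  let ?P = "{..<L} \<rightarrow>\<^sub>E {..<n}"
  have "(\<Sum>k<n. cnj (w ^ i) ^ k * (\<Prod>l<L. \<Sum>j<n. (w ^ k) ^ j * a l j))
     = (\<Sum>k<n. \<Sum>c\<in>?P. cnj (w ^ i) ^ k * (w ^ (\<Sum>l<L. c l)) ^ k * (\<Prod>l<L. a l (c l)))"
  proof (rule sum.cong[OF refl])
    fix k
    have "(\<Prod>l<L. (w ^ k) ^ c l * a l (c l)) = (w ^ (\<Sum>l<L. c l)) ^ k * (\<Prod>l<L. a l (c l))" for c
      by (simp add: prod.distrib power_sum[symmetric] power_mult[symmetric] sum_distrib_left mult.commute)
    moreover have "(\<Prod>l<L. \<Sum>j<n. (w ^ k) ^ j * a l j) = (\<Sum>c\<in>?P. \<Prod>l<L. (w ^ k) ^ c l * a l (c l))"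
      by (rule prod_sum_PiE) auto
    ultimately show "cnj (w ^ i) ^ k * (\<Prod>l<L. \<Sum>j<n. (w ^ k) ^ j * a l j)
      = (\<Sum>c\<in>?P. cnj (w ^ i) ^ k * (w ^ (\<Sum>l<L. c l)) ^ k * (\<Prod>l<L. a l (c l)))"
      by (simp only: sum_distrib_left mult.assoc)
  qed
  also have "\<dots> = (\<Sum>c\<in>?P. \<Sum>k<n. cnj (w ^ i) ^ k * (w ^ (\<Sum>l<L. c l)) ^ k * (\<Prod>l<L. a l (c l)))"
    by (rule sum.swap)
  also have "\<dots> = (\<Sum>c\<in>?P. if (\<Sum>l<L. c l) mod n = i then of_nat n * (\<Prod>l<L. a l (c l)) else 0)"
    unfolding sum_distrib_right[symmetric] root_unity_indicator[OF n w i]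
    by (intro sum.cong refl) auto
  also have "\<dots> = of_nat n * (\<Sum>c\<in>strings n L i. \<Prod>l<L. a l (c l))"
    unfolding strings_def sum_distrib_left
    by (rule sum.inter_filter[symmetric]) (simp add: finite_PiE)
  finally show ?thesis using n by simp
qed

text \<open>The factor \<open>n\<close> before \<open>t ^ L\<close> is a count: \<open>n\<close>
  outcomes, each with weight \<open>1 / n\<close>, and \<open>n - 1\<close> nontrivial characters
  per outcome, rounded up to \<open>n\<close>.\<close>

lemma success_strings_le:
  fixes L :: nat
  assumes S: "finite S" and n1: "1 < n"
    and tr: "(\<Sum>i<n. \<Sum>x\<in>S. X i x x) = 1"
    and w: "w ^ n = 1" "cmod w = 1" "inj_on (\<lambda>k. w ^ k) {..<n}"
    and t: "\<And>k. 0 < k \<Longrightarrow> k < n \<Longrightarrow> trace_norm_le S (\<lambda>x y. \<Sum>i<n. (w ^ k) ^ i * X i x y) t"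
    and N: "povm ({..<L} \<rightarrow>\<^sub>E S) n N"
  shows "(\<Sum>i<n. Re (trace_prod ({..<L} \<rightarrow>\<^sub>E S) (\<lambda>f g. \<Sum>c\<in>strings n L i. \<Prod>l<L. X (c l) (f l) (g l)) (N i)))
    \<le> 1 / n + n * t ^ L"
proof -
  let ?P = "{..<L} \<rightarrow>\<^sub>E S"
  have n: "0 < n" using n1 by simp
  have fP: "finite ?P" using S by (simp add: finite_PiE)
  define Y where "Y = (\<lambda>k x y. \<Sum>i<n. (w ^ k) ^ i * X i x y)"
  define \<tau> where "\<tau> = (\<lambda>k i. trace_prod ?P (\<lambda>f g. \<Prod>l<L. Y k (f l) (g l)) (N i))"
  have t0: "0 \<le> t"
    using t[of 1] n1 trace_norm_le_nonneg by auto
  have bound: "cmod (\<tau> k i) \<le> t ^ L" if "0 < k" "k < n" "i < n" for k i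
    using trace_norm_le_PiE[OF S t[OF that(1,2)], of L] povm_contraction[OF fP N that(3)]
    unfolding trace_norm_le_def \<tau>_def Y_def by (subst trace_prod_commute) blast
  \<comment> \<open>The elements \<open>N i\<close> add up to the identity, so only the trace of the
    \<open>L\<close>-th tensor power of \<open>Y 0\<close> remains, and \<open>Y 0\<close> is the
    sum of all \<open>X i\<close>, of trace 1.\<close>
  have zero: "(\<Sum>i<n. \<tau> 0 i) = 1"
  proof -
    have "(\<Sum>i<n. \<tau> 0 i) = trace_prod ?P (\<lambda>f g. \<Sum>i<n. N i f g) (\<lambda>f g. \<Prod>l<L. Y 0 (f l) (g l))"
      unfolding \<tau>_def trace_prod_sum by (simp add: trace_prod_commute)
    also have "\<dots> = (\<Sum>f\<in>?P. \<Prod>l<L. Y 0 (f l) (f l))"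
      using N by (subst trace_prod_commute, intro trace_prod_id fP) (simp add: povm_def)
    also have "\<dots> = (\<Sum>x\<in>S. Y 0 x x) ^ L" 
      using prod_sum_PiE[of "{..<L}" "\<lambda>_. S" "\<lambda>_ x. Y 0 x x"] S by simp
    also have "(\<Sum>x\<in>S. Y 0 x x) = 1"
      unfolding Y_def using tr by (subst sum.swap) simp
    finally show ?thesis by simp
  qed
  have "trace_prod ?P (\<lambda>f g. \<Sum>c\<in>strings n L i. \<Prod>l<L. X (c l) (f l) (g l)) (N i)
     = of_real (1 / n) * (\<Sum>k<n. cnj (w ^ i) ^ k * \<tau> k i)" if "i < n" for i
    unfolding Pi_strings_fourier[OF n w that, where a = "\<lambda>l j. X j (f l) (g l)" for f g]
      trace_prod_scale trace_prod_sum \<tau>_def Y_def ..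
  then have "(\<Sum>i<n. Re (trace_prod ?P (\<lambda>f g. \<Sum>c\<in>strings n L i. \<Prod>l<L. X (c l) (f l) (g l)) (N i)))
     = (\<Sum>i<n. 1 / n * Re (\<Sum>k<n. cnj (w ^ i) ^ k * \<tau> k i))"
    by (intro sum.cong refl) simp
  also have "\<dots> \<le> (\<Sum>i<n. 1 / n * (Re (\<tau> 0 i) + n * t ^ L))"
  proof (intro sum_mono mult_left_mono)
    fix i assume "i \<in> {..<n}"
    then have i: "i < n" by simp
    have "(\<Sum>k<n. cnj (w ^ i) ^ k * \<tau> k i) = \<tau> 0 i + (\<Sum>k\<in>{..<n} - {0}. cnj (w ^ i) ^ k * \<tau> k i)"
      using n by (subst sum.remove[of _ 0]) auto
    moreover have "Re (\<Sum>k\<in>{..<n} - {0}. cnj (w ^ i) ^ k * \<tau> k i) \<le> real n * t ^ L"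
    proof -
      have "Re (\<Sum>k\<in>{..<n} - {0}. cnj (w ^ i) ^ k * \<tau> k i) \<le> cmod (\<Sum>k\<in>{..<n} - {0}. cnj (w ^ i) ^ k * \<tau> k i)"
        by (rule complex_Re_le_cmod)
      also have "\<dots> \<le> (\<Sum>k\<in>{..<n} - {0}. t ^ L)"
        using bound i w(2) by (intro sum_norm_le) (auto simp: norm_mult norm_power)
      also have "\<dots> = real (n - 1) * t ^ L" using n by simp
      also have "\<dots> \<le> real n * t ^ L"
        using t0 by (intro mult_right_mono zero_le_power) auto
      finally show ?thesis .
    qed
    ultimately show "Re (\<Sum>k<n. cnj (w ^ i) ^ k * \<tau> k i) \<le> Re (\<tau> 0 i) + real n * t ^ L" by simp
  qed simp
  also have "\<dots> = 1 / n * (Re (\<Sum>i<n. \<tau> 0 i) + n * (n * t ^ L))"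
    unfolding sum_distrib_left[symmetric] by (simp add: sum.distrib)
  also have "\<dots> = 1 / n + n * t ^ L"
    using n unfolding zero by (simp add: field_simps)
  finally show ?thesis .
qed

section \<open>Matrices, partial transposition and LOCC\<close>

abbreviation entries :: "complex mat \<Rightarrow> nat \<Rightarrow> nat \<Rightarrow> complex" where
  "entries A \<equiv> \<lambda>x y. A $$ (x, y)"

lemma psd_iff: "psd d A \<longleftrightarrow> A \<in> carrier_mat d d \<and> psd_on {..<d} (entries A)"
proof (cases "A \<in> carrier_mat d d")
  case True
  have f: "(A *\<^sub>v v) \<bullet>c v = form {..<d} (entries A) (\<lambda>i. v $ i) (\<lambda>i. v $ i)" if "v \<in> carrier_vec d" for v
    using True that
    by (auto simp: scalar_prod_def form_alt atLeast0LessThan mult.commute intro!: sum.cong)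
  have "(\<forall>v\<in>carrier_vec d. 0 \<le> (A *\<^sub>v v) \<bullet>c v) \<longleftrightarrow> psd_on {..<d} (entries A)"
    unfolding psd_on_def
  proof (intro iffI allI ballI)
    fix v assume "\<forall>v\<in>carrier_vec d. 0 \<le> (A *\<^sub>v v) \<bullet>c v"
    then have "0 \<le> (A *\<^sub>v vec d v) \<bullet>c vec d v" by (rule bspec) simp
    also have "\<dots> = form {..<d} (entries A) (\<lambda>i. vec d v $ i) (\<lambda>i. vec d v $ i)"
      by (rule f) simp
    also have "\<dots> = form {..<d} (entries A) v v"
      by (rule form_cong) auto
    finally show "0 \<le> form {..<d} (entries A) v v" .
  next
    fix v :: "complex vec" assume "\<forall>v. 0 \<le> form {..<d} (entries A) v v" "v \<in> carrier_vec d"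
    then show "0 \<le> (A *\<^sub>v v) \<bullet>c v" using f by simp
  qed
  then show ?thesis using True by (simp add: psd_def)
qed (simp add: psd_def)

lemma mat_trace_mult:
  assumes "A \<in> carrier_mat d d" "B \<in> carrier_mat d d"
  shows "mat_trace (A * B) = trace_prod {..<d} (entries A) (entries B)"
  using assms
  by (auto simp: mat_trace_def trace_prod_def scalar_prod_def atLeast0LessThan intro!: sum.cong)

lemma measurement_iff:
  "measurement d n M \<longleftrightarrow> (\<forall>i<n. M i \<in> carrier_mat d d) \<and> povm {..<d} n (\<lambda>i. entries (M i))"
proof -
  have "mat_sum d M {..<n} = 1\<^sub>m d \<longleftrightarrow>
      (\<forall>x\<in>{..<d}. \<forall>y\<in>{..<d}. (\<Sum>i<n. M i $$ (x, y)) = (if x = y then 1 else 0))"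
    by (auto simp: mat_sum_def mat_eq_iff)
  then show ?thesis by (auto simp: measurement_def povm_def psd_iff)
qed

lemma bij_betw_div_mod:
  "bij_betw (\<lambda>x. (x div dB, x mod dB)) {..<dA * dB} ({..<dA} \<times> {..<(dB::nat)})"
proof (rule bij_betw_byWitness[where f' = "\<lambda>(a, b). a * dB + b"])
  have "a * dB + b < dA * dB" if "a < dA" "b < dB" for a b
  proof -
    have "a * dB + b < Suc a * dB" using that(2) by simp
    also have "\<dots> \<le> dA * dB" using that(1) by (intro mult_le_mono1) simp
    finally show ?thesis .
  qed
  then show "(\<lambda>(a, b). a * dB + b) ` ({..<dA} \<times> {..<dB}) \<subseteq> {..<dA * dB}" by auto
  show "(\<lambda>x. (x div dB, x mod dB)) ` {..<dA * dB} \<subseteq> {..<dA} \<times> {..<dB}"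
    by (auto simp: less_mult_imp_div_less) (metis mod_less_divisor mult_0_right not_less_zero gr0I)
qed auto

lemma pair_index_less:
  "a < dA \<Longrightarrow> b < dB \<Longrightarrow> a * dB + b < dA * (dB::nat)"
  using bij_betw_div_mod[of dB dA]
  by (metis add.commute add_lessD1 less_imp_add_positive mult_Suc mult_le_mono1 Suc_leI nat_add_left_cancel_less order_less_le_trans)

lemma pair_index_eq_iff:
  assumes "b < dB" "b' < (dB::nat)"
  shows "a * dB + b = a' * dB + b' \<longleftrightarrow> a = a' \<and> b = b'"
proof
  assume *: "a * dB + b = a' * dB + b'"
  have "a = (a * dB + b) div dB" using assms by simp
  also have "\<dots> = a'" unfolding * using assms by simp
  finally show "a = a' \<and> b = b'" using * by simp
qed simp

text \<open>With \<open>sum_if_zero\<close>, these move the Kronecker deltas of identity factors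
  outward until \<open>simp\<close> can collapse the sums.\<close>

lemma mult_if_zero:
  "(if P then x else 0) * y = (if P then x * y else (0::complex))"
  "y * (if P then x else 0) = (if P then y * x else (0::complex))"
  "cnj (if P then x else 0) = (if P then cnj x else 0)"
  by simp_all

lemma sum_if_zero: "(\<Sum>x\<in>S. if P then f x else 0) = (if P then \<Sum>x\<in>S. f x else (0::complex))"
  by simp

lemma sum_pair_index:
  fixes f :: "nat \<Rightarrow> complex"
  shows "(\<Sum>x<dA * dB. f x) = (\<Sum>a<dA. \<Sum>b<dB. f (a * dB + b))"
proof -
  have "(\<Sum>x<dA * dB. f x) = (\<Sum>x<dA * dB. (\<lambda>p. f (fst p * dB + snd p)) (x div dB, x mod dB))"
    by simp
  also have "\<dots> = (\<Sum>p\<in>{..<dA} \<times> {..<dB}. f (fst p * dB + snd p))"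
    by (rule sum.reindex_bij_betw[OF bij_betw_div_mod])
  finally show ?thesis by (simp add: sum.cartesian_product')
qed

section \<open>Partial transposition and the positivity it keeps under LOCC\<close>

text \<open>Positivity of the partial transpose, stated on pairs of indices instead of through
  \<open>div\<close> and \<open>mod\<close>, so that a local Kraus operator touches one component
  only.\<close>

definition ppt :: "nat \<Rightarrow> nat \<Rightarrow> complex mat \<Rightarrow> bool" where
  "ppt dA dB M \<longleftrightarrow> psd_on ({..<dA} \<times> {..<dB})
     (\<lambda>p q. M $$ (fst p * dB + snd q, fst q * dB + snd p))"

lemma partial_transpose_carrier [simp]: "partial_transpose dA dB X \<in> carrier_mat (dA * dB) (dA * dB)"
  by (simp add: partial_transpose_def)

lemma partial_transpose_pair:
  assumes "a < dA" "b < dB" "a' < dA" "b' < dB"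
  shows "partial_transpose dA dB X $$ (a * dB + b, a' * dB + b') = X $$ (a * dB + b', a' * dB + b)"
  using assms by (simp add: partial_transpose_def pair_index_less)

lemma psd_partial_transpose:
  assumes "ppt dA dB M"
  shows "psd_on {..<dA * dB} (entries (partial_transpose dA dB M))"
  using psd_on_bij[OF bij_betw_div_mod assms[unfolded ppt_def]]
  by (rule psd_on_cong[THEN iffD1, rotated]) (simp add: partial_transpose_def)

text \<open>Both factors have Bob's row and column index exchanged, and both of these are summed
  over, so renaming them restores the original trace. This transfers the transposition from the
  measurement to the states.\<close>

lemma trace_prod_partial_transpose:
  "trace_prod {..<dA * dB} (entries (partial_transpose dA dB X)) (entries (partial_transpose dA dB M))
     = trace_prod {..<dA * dB} (entries X) (entries M)"
proof -
  have "trace_prod {..<dA * dB} (entries (partial_transpose dA dB X)) (entries (partial_transpose dA dB M))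
     = (\<Sum>a<dA. \<Sum>b<dB. \<Sum>a'<dA. \<Sum>b'<dB.
          X $$ (a * dB + b', a' * dB + b) * M $$ (a' * dB + b, a * dB + b'))"
    unfolding trace_prod_def sum_pair_index
    by (intro sum.cong refl) (simp add: partial_transpose_pair)
  also have "\<dots> = (\<Sum>a<dA. \<Sum>a'<dA. \<Sum>b<dB. \<Sum>b'<dB.
          X $$ (a * dB + b', a' * dB + b) * M $$ (a' * dB + b, a * dB + b'))"
    by (intro sum.cong refl sum.swap)
  also have "\<dots> = (\<Sum>a<dA. \<Sum>a'<dA. \<Sum>b'<dB. \<Sum>b<dB.
          X $$ (a * dB + b', a' * dB + b) * M $$ (a' * dB + b, a * dB + b'))"
    by (intro sum.cong refl sum.swap)
  also have "\<dots> = (\<Sum>a<dA. \<Sum>b'<dB. \<Sum>a'<dA. \<Sum>b<dB.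
          X $$ (a * dB + b', a' * dB + b) * M $$ (a' * dB + b, a * dB + b'))"
    by (intro sum.cong refl sum.swap)
  finally show ?thesis unfolding trace_prod_def sum_pair_index .
qed

text \<open>The identity is its own partial transpose, so completeness is kept; positivity is what
  \<open>ppt\<close> provides.\<close>

lemma measurement_partial_transpose:
  assumes M: "measurement (dA * dB) n M" and ppt: "\<And>i. i < n \<Longrightarrow> ppt dA dB (M i)"
  shows "measurement (dA * dB) n (\<lambda>i. partial_transpose dA dB (M i))"
proof -
  have "(\<Sum>i<n. partial_transpose dA dB (M i) $$ (x, y)) = (if x = y then 1 else 0)"
    if "x < dA * dB" "y < dA * dB" for x y
  proof -
    have "x div dB < dA" "x mod dB < dB" "y div dB < dA" "y mod dB < dB"
      using bij_betw_div_mod[of dB dA] that by (auto simp: bij_betw_def)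
    then have "(\<Sum>i<n. partial_transpose dA dB (M i) $$ (x, y))
        = (if (x div dB) * dB + y mod dB = (y div dB) * dB + x mod dB then 1 else 0)"
      using M that by (simp add: measurement_iff povm_def partial_transpose_def pair_index_less)
    also have "(x div dB) * dB + y mod dB = (y div dB) * dB + x mod dB \<longleftrightarrow> x = y"
      using pair_index_eq_iff[OF \<open>y mod dB < dB\<close> \<open>x mod dB < dB\<close>]
      by (metis div_mult_mod_eq)
    finally show ?thesis .
  qed
  then show ?thesis
    using ppt psd_partial_transpose by (simp add: measurement_iff povm_def)
qed

text \<open>The form at \<open>v\<close> is the form of \<open>B\<close> at \<open>E\<close> applied
  to \<open>v\<close>.\<close>

lemma psd_on_sandwich:
  assumes "psd_on T B"
  shows "psd_on S (\<lambda>x y. \<Sum>z\<in>T. \<Sum>w\<in>T. cnj (E z x) * B z w * E w y)"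
  unfolding psd_on_def
proof
  fix v
  define u where "u = (\<lambda>z. \<Sum>x\<in>S. E z x * v x)"
  have "form S (\<lambda>x y. \<Sum>z\<in>T. \<Sum>w\<in>T. cnj (E z x) * B z w * E w y) v v
      = (\<Sum>z\<in>T. \<Sum>w\<in>T. form S (\<lambda>x y. cnj (E z x) * B z w * E w y) v v)"
    by (simp only: form_sum)
  also have "\<dots> = form T B u u"
    unfolding form_def[of T]
  proof (intro sum.cong refl)
    fix z w
    have "form S (\<lambda>x y. cnj (E z x) * B z w * E w y) v v
        = (\<Sum>x\<in>S. \<Sum>y\<in>S. B z w * (cnj (E z x * v x) * (E w y * v y)))"
      by (simp add: form_def mult_ac)
    also have "\<dots> = B z w * (\<Sum>x\<in>S. \<Sum>y\<in>S. cnj (E z x * v x) * (E w y * v y))"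
      by (simp only: sum_distrib_left)
    also have "\<dots> = B z w * (cnj (u z) * u w)"
      by (simp only: u_def cnj_sum sum_product)
    finally show "form S (\<lambda>x y. cnj (E z x) * B z w * E w y) v v = cnj (u z) * B z w * u w"
      by (simp add: mult_ac)
  qed
  finally show "0 \<le> form S (\<lambda>x y. \<Sum>z\<in>T. \<Sum>w\<in>T. cnj (E z x) * B z w * E w y) v v"
    using assms by (simp add: psd_on_def)
qed

lemma mat_adjoint_carrier:
  assumes "E \<in> carrier_mat m d"
  shows "mat_adjoint E \<in> carrier_mat d m"
  using assms by (auto simp: mat_adjoint_def)

lemma mat_adjoint_index:
  assumes "E \<in> carrier_mat m d" "x < d" "z < m"
  shows "mat_adjoint E $$ (x, z) = cnj (E $$ (z, x))"
  using assms by (simp add: mat_adjoint_def mat_of_rows_def)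

lemma sandwich_index:
  assumes E: "E \<in> carrier_mat m d" and N: "N \<in> carrier_mat m m" and "x < d" "y < d"
  shows "(mat_adjoint E * N * E) $$ (x, y)
    = (\<Sum>z<m. \<Sum>w<m. cnj (E $$ (z, x)) * N $$ (z, w) * E $$ (w, y))"
proof -
  note A = mat_adjoint_carrier[OF E]
  have AN: "(mat_adjoint E * N) $$ (x, w) = (\<Sum>z<m. cnj (E $$ (z, x)) * N $$ (z, w))" if "w < m" for w
    using assms A that
    by (auto simp: scalar_prod_def atLeast0LessThan mat_adjoint_index[OF E] intro!: sum.cong)
  have "(mat_adjoint E * N * E) $$ (x, y) = row (mat_adjoint E * N) x \<bullet> col E y"
    using assms A by (intro index_mult_mat(1)) auto
  also have "\<dots> = (\<Sum>w<m. (mat_adjoint E * N) $$ (x, w) * E $$ (w, y))"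
    unfolding scalar_prod_def using assms A
    by (intro sum.cong) auto
  also have "\<dots> = (\<Sum>w<m. (\<Sum>z<m. cnj (E $$ (z, x)) * N $$ (z, w)) * E $$ (w, y))"
    by (intro sum.cong refl) (simp add: AN)
  also have "\<dots> = (\<Sum>w<m. \<Sum>z<m. cnj (E $$ (z, x)) * N $$ (z, w) * E $$ (w, y))"
    by (simp add: sum_distrib_right)
  also have "\<dots> = (\<Sum>z<m. \<Sum>w<m. cnj (E $$ (z, x)) * N $$ (z, w) * E $$ (w, y))"
    by (rule sum.swap)
  finally show ?thesis .
qed

lemma kron_carrier:
  assumes "A \<in> carrier_mat a b" "B \<in> carrier_mat c d"
  shows "kron A B \<in> carrier_mat (a * c) (b * d)"
  using assms by (auto simp: kron_def)

lemma kron_index: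
  assumes "A \<in> carrier_mat a b" "B \<in> carrier_mat c d" "x < a" "y < b" "z < c" "w < d"
  shows "kron A B $$ (x * c + z, y * d + w) = A $$ (x, y) * B $$ (z, w)"
  using assms by (auto simp: kron_def pair_index_less)

text \<open>Transposing Bob's factor leaves Alice's operator alone: the transposed sandwich is the
  sandwich of the transposed \<open>N\<close> by the same Kraus operator.\<close>

lemma ppt_alice:
  assumes K: "K \<in> carrier_mat d' dA" and N: "N \<in> carrier_mat (d' * dB) (d' * dB)" and ppt: "ppt d' dB N"
  shows "ppt dA dB (mat_adjoint (kron K (1\<^sub>m dB)) * N * kron K (1\<^sub>m dB))"
proof -
  let ?E = "kron K (1\<^sub>m dB)"
  have E: "?E \<in> carrier_mat (d' * dB) (dA * dB)" using K by (intro kron_carrier) auto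
  have Ei: "?E $$ (p * dB + c, a * dB + b) = (if c = b then K $$ (p, a) else 0)"
    if "p < d'" "c < dB" "a < dA" "b < dB" for p c a b
    using kron_index[OF K one_carrier_mat that(1,3,2,4)] that by simp
  have "psd_on ({..<dA} \<times> {..<dB}) (\<lambda>p q. \<Sum>z\<in>{..<d'} \<times> {..<dB}. \<Sum>w\<in>{..<d'} \<times> {..<dB}.
      cnj (if snd z = snd p then K $$ (fst z, fst p) else 0) *
      N $$ (fst z * dB + snd w, fst w * dB + snd z) * (if snd w = snd q then K $$ (fst w, fst q) else 0))"
    by (rule psd_on_sandwich[OF ppt[unfolded ppt_def]])
  then show ?thesis
    unfolding ppt_def
  proof (rule psd_on_cong[THEN iffD1, rotated])
    fix x y assume "x \<in> {..<dA} \<times> {..<dB}" "y \<in> {..<dA} \<times> {..<dB}"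
    then obtain a b a' b' where xy: "x = (a, b)" "y = (a', b')" "a < dA" "b < dB" "a' < dA" "b' < dB"
      by auto
    have "(mat_adjoint ?E * N * ?E) $$ (a * dB + b', a' * dB + b)
      = (\<Sum>p<d'. \<Sum>c<dB. \<Sum>q<d'. \<Sum>c'<dB. cnj (if c = b' then K $$ (p, a) else 0) *
           N $$ (p * dB + c, q * dB + c') * (if c' = b then K $$ (q, a') else 0))"
      using xy by (subst sandwich_index[OF E N]) (simp_all add: pair_index_less sum_pair_index Ei cong: sum.cong_simp)
    also have "\<dots> = (\<Sum>p<d'. \<Sum>q<d'. cnj (K $$ (p, a)) * N $$ (p * dB + b', q * dB + b) * K $$ (q, a'))"
      using xy by (simp add: mult_if_zero sum_if_zero)
    finally have 1: "(mat_adjoint ?E * N * ?E) $$ (a * dB + b', a' * dB + b)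
       = (\<Sum>p<d'. \<Sum>q<d'. cnj (K $$ (p, a)) * N $$ (p * dB + b', q * dB + b) * K $$ (q, a'))" .
    have "(\<Sum>z\<in>{..<d'} \<times> {..<dB}. \<Sum>w\<in>{..<d'} \<times> {..<dB}.
        cnj (if snd z = snd x then K $$ (fst z, fst x) else 0) *
        N $$ (fst z * dB + snd w, fst w * dB + snd z) * (if snd w = snd y then K $$ (fst w, fst y) else 0))
      = (\<Sum>p<d'. \<Sum>q<d'. cnj (K $$ (p, a)) * N $$ (p * dB + b', q * dB + b) * K $$ (q, a'))"
      unfolding sum.cartesian_product' using xy by (simp add: mult_if_zero sum_if_zero)
    then show "(\<Sum>z\<in>{..<d'} \<times> {..<dB}. \<Sum>w\<in>{..<d'} \<times> {..<dB}.
        cnj (if snd z = snd x then K $$ (fst z, fst x) else 0) *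
        N $$ (fst z * dB + snd w, fst w * dB + snd z) * (if snd w = snd y then K $$ (fst w, fst y) else 0))
      = (mat_adjoint ?E * N * ?E) $$ (fst x * dB + snd y, fst y * dB + snd x)"
      using 1 xy by simp
  qed
qed

text \<open>Transposition reverses the product on Bob's side, which turns the sandwich by
  \<open>K\<close> into a sandwich of the transposed \<open>N\<close> by the entrywise conjugate of
  \<open>K\<close>.\<close>

lemma ppt_bob:
  assumes K: "K \<in> carrier_mat d' dB" and N: "N \<in> carrier_mat (dA * d') (dA * d')" and ppt: "ppt dA d' N"
  shows "ppt dA dB (mat_adjoint (kron (1\<^sub>m dA) K) * N * kron (1\<^sub>m dA) K)"
proof -
  let ?E = "kron (1\<^sub>m dA) K"
  have E: "?E \<in> carrier_mat (dA * d') (dA * dB)" using K by (intro kron_carrier) auto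
  have Ei: "?E $$ (a1 * d' + p, a * dB + b) = (if a1 = a then K $$ (p, b) else 0)"
    if "a1 < dA" "p < d'" "a < dA" "b < dB" for p a1 a b
    using kron_index[OF one_carrier_mat K that(1,3,2,4)] that by simp
  have "psd_on ({..<dA} \<times> {..<dB}) (\<lambda>p q. \<Sum>z\<in>{..<dA} \<times> {..<d'}. \<Sum>w\<in>{..<dA} \<times> {..<d'}.
      cnj (if fst z = fst p then cnj (K $$ (snd z, snd p)) else 0) *
      N $$ (fst z * d' + snd w, fst w * d' + snd z) * (if fst w = fst q then cnj (K $$ (snd w, snd q)) else 0))"
    by (rule psd_on_sandwich[OF ppt[unfolded ppt_def]])
  then show ?thesis
    unfolding ppt_def
  proof (rule psd_on_cong[THEN iffD1, rotated])
    fix x y assume "x \<in> {..<dA} \<times> {..<dB}" "y \<in> {..<dA} \<times> {..<dB}"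
    then obtain a b a' b' where xy: "x = (a, b)" "y = (a', b')" "a < dA" "b < dB" "a' < dA" "b' < dB"
      by auto
    have "(mat_adjoint ?E * N * ?E) $$ (a * dB + b', a' * dB + b)
      = (\<Sum>a1<dA. \<Sum>p<d'. \<Sum>a2<dA. \<Sum>q<d'. cnj (if a1 = a then K $$ (p, b') else 0) *
           N $$ (a1 * d' + p, a2 * d' + q) * (if a2 = a' then K $$ (q, b) else 0))"
      using xy by (subst sandwich_index[OF E N]) (simp_all add: pair_index_less sum_pair_index Ei cong: sum.cong_simp)
    also have "\<dots> = (\<Sum>p<d'. \<Sum>q<d'. cnj (K $$ (p, b')) * N $$ (a * d' + p, a' * d' + q) * K $$ (q, b))"
      using xy by (simp add: mult_if_zero sum_if_zero)
    finally have 1: "(mat_adjoint ?E * N * ?E) $$ (a * dB + b', a' * dB + b)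
      = (\<Sum>p<d'. \<Sum>q<d'. cnj (K $$ (p, b')) * N $$ (a * d' + p, a' * d' + q) * K $$ (q, b))" .
    have "(\<Sum>z\<in>{..<dA} \<times> {..<d'}. \<Sum>w\<in>{..<dA} \<times> {..<d'}.
        cnj (if fst z = fst x then cnj (K $$ (snd z, snd x)) else 0) *
        N $$ (fst z * d' + snd w, fst w * d' + snd z) * (if fst w = fst y then cnj (K $$ (snd w, snd y)) else 0))
      = (\<Sum>q<d'. \<Sum>p<d'. K $$ (q, b) * N $$ (a * d' + p, a' * d' + q) * cnj (K $$ (p, b')))"
      unfolding sum.cartesian_product' using xy by (simp add: mult_if_zero sum_if_zero)
    also have "\<dots> = (\<Sum>p<d'. \<Sum>q<d'. K $$ (q, b) * N $$ (a * d' + p, a' * d' + q) * cnj (K $$ (p, b')))"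
      by (rule sum.swap)
    finally show "(\<Sum>z\<in>{..<dA} \<times> {..<d'}. \<Sum>w\<in>{..<dA} \<times> {..<d'}.
        cnj (if fst z = fst x then cnj (K $$ (snd z, snd x)) else 0) *
        N $$ (fst z * d' + snd w, fst w * d' + snd z) * (if fst w = fst y then cnj (K $$ (snd w, snd y)) else 0))
      = (mat_adjoint ?E * N * ?E) $$ (fst x * dB + snd y, fst y * dB + snd x)"
      using 1 xy by (simp add: mult_ac)
  qed
qed

lemma ppt_mat_sum:
  assumes "\<And>s. s \<in> I \<Longrightarrow> ppt dA dB (F s)"
  shows "ppt dA dB (mat_sum (dA * dB) F I)"
proof -
  have "psd_on ({..<dA} \<times> {..<dB}) (\<lambda>p q. \<Sum>s\<in>I. F s $$ (fst p * dB + snd q, fst q * dB + snd p))"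
    using assms by (intro psd_on_sum) (simp add: ppt_def)
  then show ?thesis
    unfolding ppt_def
    by (rule psd_on_cong[THEN iffD1, rotated]) (auto simp: mat_sum_def pair_index_less)
qed

text \<open>Induction on the protocol: announcing uses only the identity and zero, and pulling back
  through a local instrument preserves positivity of the partial transpose. This is all that the
  upper bound on \<open>p_L\<close> takes from \<open>locc\<close>.\<close>

lemma locc_ppt:
  assumes "locc n dA dB M"
  shows "M i \<in> carrier_mat (dA * dB) (dA * dB) \<and> ppt dA dB (M i)"
  using assms
proof (induction arbitrary: i)
  case (announce i\<^sub>0 dA dB)
  have "psd_on ({..<dA} \<times> {..<dB}) (\<lambda>p q. if p = q then 1 else 0)"
    unfolding psd_on_def by (subst form_id) (simp_all add: less_eq_complex_def)
  then have "ppt dA dB (1\<^sub>m (dA * dB))"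
    unfolding ppt_def
  proof (rule psd_on_cong[THEN iffD1, rotated])
    fix p q assume "p \<in> {..<dA} \<times> {..<dB}" "q \<in> {..<dA} \<times> {..<dB}"
    then obtain a b a' b' where pq: "p = (a, b)" "q = (a', b')" "a < dA" "b < dB" "a' < dA" "b' < dB"
      by auto
    then show "(if p = q then 1 else 0) = 1\<^sub>m (dA * dB) $$ (fst p * dB + snd q, fst q * dB + snd p)"
      by (auto simp: pair_index_less pair_index_eq_iff)
  qed
  moreover have "ppt dA dB (0\<^sub>m (dA * dB) (dA * dB))"
  proof -
    have "psd_on ({..<dA} \<times> {..<dB}) (\<lambda>p q. 0)" by (simp add: psd_on_def form_def)
    then show ?thesis
      unfolding ppt_def by (rule psd_on_cong[THEN iffD1, rotated]) (auto simp: pair_index_less)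
  qed
  ultimately show ?case by simp
next
  case (alice dA m r d' K dB N)
  have "ppt dA dB (mat_sum (dA * dB)
      (\<lambda>(k, j). mat_adjoint (kron (K k j) (1\<^sub>m dB)) * N k i * kron (K k j) (1\<^sub>m dB))
      (SIGMA k:{..<m}. {..<r k}))"
    using alice by (intro ppt_mat_sum) (auto simp: instrument_def intro!: ppt_alice)
  then show ?case by (simp add: mat_sum_def)
next
  case (bob dB m r d' K dA N)
  have "ppt dA dB (mat_sum (dA * dB)
      (\<lambda>(k, j). mat_adjoint (kron (1\<^sub>m dA) (K k j)) * N k i * kron (1\<^sub>m dA) (K k j))
      (SIGMA k:{..<m}. {..<r k}))"
    using bob by (intro ppt_mat_sum) (auto simp: instrument_def intro!: ppt_bob)
  then show ?case by (simp add: mat_sum_def)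
qed

section \<open>Many copies\<close>

lemma digits_inj:
  fixes d x y :: nat
  assumes "x < d ^ L" "y < d ^ L" "\<And>l. l < L \<Longrightarrow> x div d ^ l mod d = y div d ^ l mod d"
  shows "x = y"
  using assms
proof (induction L arbitrary: x y)
  case 0
  then show ?case by simp
next
  case (Suc L)
  have "x div d = y div d"
  proof (rule Suc.IH)
    show "x div d < d ^ L" "y div d < d ^ L"
      using Suc.prems(1,2) by (simp_all add: less_mult_imp_div_less mult.commute)
    show "x div d div d ^ l mod d = y div d div d ^ l mod d" if "l < L" for l
      using Suc.prems(3)[of "Suc l"] that by (simp add: div_mult2_eq)
  qed
  moreover have "x mod d = y mod d" using Suc.prems(3)[of 0] by simp
  ultimately show ?case by (metis div_mult_mod_eq)
qed

text \<open>Restricting makes the tuple of one-copy indices extensional, which injectivity into the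
  function space requires.\<close>

definition copies :: "nat \<Rightarrow> nat \<Rightarrow> nat \<Rightarrow> nat \<Rightarrow> nat \<Rightarrow> nat" where
  "copies dA dB L x = restrict (\<lambda>l. copy_index dA dB L l x) {..<L}"

context
  fixes dA dB :: nat
  assumes pos: "0 < dA" "0 < dB"
begin

lemma copy_index_less: "copy_index dA dB L l x < dA * dB"
  unfolding copy_index_def using pos by (intro pair_index_less) auto

lemma copy_index_div_mod:
  "copy_index dA dB L l x div dB = (x div dB ^ L) div dA ^ l mod dA"
  "copy_index dA dB L l x mod dB = (x mod dB ^ L) div dB ^ l mod dB"
  unfolding copy_index_def using pos by simp_all

text \<open>Injective because an index is determined by its digits, for Alice in base
  \<open>dA\<close> and for Bob in base \<open>dB\<close>; surjective by counting, both sides having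
  \<open>(dA * dB) ^ L\<close> elements.\<close>

lemma bij_betw_copies:
  "bij_betw (copies dA dB L) {..<dA ^ L * dB ^ L} ({..<L} \<rightarrow>\<^sub>E {..<dA * dB})"
proof -
  have inj: "inj_on (copies dA dB L) {..<dA ^ L * dB ^ L}"
  proof (rule inj_onI)
    fix x y assume xy: "x \<in> {..<dA ^ L * dB ^ L}" "y \<in> {..<dA ^ L * dB ^ L}"
      and eq: "copies dA dB L x = copies dA dB L y"
    have c: "copy_index dA dB L l x = copy_index dA dB L l y" if "l < L" for l
      using fun_cong[OF eq, of l] that by (simp add: copies_def)
    have "x div dB ^ L = y div dB ^ L"
    proof (rule digits_inj)
      show "x div dB ^ L < dA ^ L" "y div dB ^ L < dA ^ L"
        using xy by (simp_all add: less_mult_imp_div_less)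
      show "x div dB ^ L div dA ^ l mod dA = y div dB ^ L div dA ^ l mod dA" if "l < L" for l
        using c[OF that] by (metis copy_index_div_mod(1))
    qed
    moreover have "x mod dB ^ L = y mod dB ^ L"
    proof (rule digits_inj)
      show "x mod dB ^ L < dB ^ L" "y mod dB ^ L < dB ^ L"
        using pos by simp_all
      show "x mod dB ^ L div dB ^ l mod dB = y mod dB ^ L div dB ^ l mod dB" if "l < L" for l
        using c[OF that] by (metis copy_index_div_mod(2))
    qed
    ultimately show "x = y" by (metis div_mult_mod_eq)
  qed
  have sub: "copies dA dB L ` {..<dA ^ L * dB ^ L} \<subseteq> ({..<L} \<rightarrow>\<^sub>E {..<dA * dB})"
    by (intro image_subsetI) (simp add: copies_def copy_index_less)
  have "copies dA dB L ` {..<dA ^ L * dB ^ L} = ({..<L} \<rightarrow>\<^sub>E {..<dA * dB})"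
    by (rule card_subset_eq[OF _ sub])
      (simp_all add: finite_PiE card_image[OF inj] card_PiE power_mult_distrib)
  with inj show ?thesis by (simp add: bij_betw_def)
qed

lemma string_state_index:
  assumes "x < dA ^ L * dB ^ L" "y < dA ^ L * dB ^ L"
  shows "string_state dA dB X L c $$ (x, y)
    = (\<Prod>l<L. X (c l) $$ (copies dA dB L x l, copies dA dB L y l))"
  using assms by (simp add: string_state_def copies_def)

lemma psd_string_state:
  assumes "\<And>l. l < L \<Longrightarrow> psd (dA * dB) (X (c l))"
  shows "psd_on {..<dA ^ L * dB ^ L} (entries (string_state dA dB X L c))"
proof -
  have "psd_on ({..<L} \<rightarrow>\<^sub>E {..<dA * dB}) (\<lambda>f g. \<Prod>l<L. entries (X (c l)) (f l) (g l))"
    using assms by (intro psd_on_PiE) (auto simp: psd_iff)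
  from psd_on_bij[OF bij_betw_copies this] show ?thesis
    by (rule psd_on_cong[THEN iffD1, rotated]) (simp add: string_state_index)
qed

lemma trace_prod_string_state:
  "trace_prod {..<dA ^ L * dB ^ L} (entries (string_state dA dB X L c)) M
   = trace_prod ({..<L} \<rightarrow>\<^sub>E {..<dA * dB}) (\<lambda>f g. \<Prod>l<L. X (c l) $$ (f l, g l))
       (\<lambda>f g. M (inv_into {..<dA ^ L * dB ^ L} (copies dA dB L) f) (inv_into {..<dA ^ L * dB ^ L} (copies dA dB L) g))"
  using bij_betw_imp_inj_on[OF bij_betw_copies]
  by (subst trace_prod_bij[OF bij_betw_copies, symmetric], intro trace_prod_cong)
     (simp_all add: string_state_index)

lemma trace_prod_string_states:
  "trace_prod {..<dA ^ L * dB ^ L} (entries (string_state dA dB X L c)) (entries (string_state dA dB Y L c'))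
   = (\<Prod>l<L. trace_prod {..<dA * dB} (entries (X (c l))) (entries (Y (c' l))))"
proof -
  let ?P = "{..<L} \<rightarrow>\<^sub>E {..<dA * dB}"
  have "trace_prod {..<dA ^ L * dB ^ L} (entries (string_state dA dB X L c)) (entries (string_state dA dB Y L c'))
     = trace_prod {..<dA ^ L * dB ^ L}
        (\<lambda>x y. \<Prod>l<L. X (c l) $$ (copies dA dB L x l, copies dA dB L y l))
        (\<lambda>x y. \<Prod>l<L. Y (c' l) $$ (copies dA dB L x l, copies dA dB L y l))"
    by (rule trace_prod_cong) (auto simp: string_state_index)
  also have "\<dots> = trace_prod ?P (\<lambda>f g. \<Prod>l<L. X (c l) $$ (f l, g l)) (\<lambda>f g. \<Prod>l<L. Y (c' l) $$ (f l, g l))"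
    by (rule trace_prod_bij[OF bij_betw_copies])
  also have "\<dots> = (\<Sum>f\<in>?P. \<Sum>g\<in>?P. \<Prod>l<L. X (c l) $$ (f l, g l) * Y (c' l) $$ (g l, f l))"
    by (simp add: trace_prod_def prod.distrib)
  also have "\<dots> = (\<Sum>f\<in>?P. \<Prod>l<L. \<Sum>y<dA * dB. X (c l) $$ (f l, y) * Y (c' l) $$ (y, f l))"
    by (intro sum.cong refl prod_sum_PiE[symmetric]) auto
  also have "\<dots> = (\<Prod>l<L. trace_prod {..<dA * dB} (entries (X (c l))) (entries (Y (c' l))))"
    unfolding trace_prod_def by (intro prod_sum_PiE[symmetric]) auto
  finally show ?thesis .
qed

lemma trace_string_state:
  "(\<Sum>x<dA ^ L * dB ^ L. string_state dA dB X L c $$ (x, x)) = (\<Prod>l<L. \<Sum>x<dA * dB. X (c l) $$ (x, x))"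
proof -
  let ?P = "{..<L} \<rightarrow>\<^sub>E {..<dA * dB}"
  have "(\<Sum>x<dA ^ L * dB ^ L. string_state dA dB X L c $$ (x, x))
      = (\<Sum>x<dA ^ L * dB ^ L. \<Prod>l<L. X (c l) $$ (copies dA dB L x l, copies dA dB L x l))"
    by (intro sum.cong refl) (simp add: string_state_index)
  also have "\<dots> = (\<Sum>f\<in>?P. \<Prod>l<L. X (c l) $$ (f l, f l))"
    by (rule sum.reindex_bij_betw[OF bij_betw_copies, where g = "\<lambda>f. \<Prod>l<L. X (c l) $$ (f l, f l)"])
  also have "\<dots> = (\<Prod>l<L. \<Sum>x<dA * dB. X (c l) $$ (x, x))"
    by (rule prod_sum_PiE[symmetric]) auto
  finally show ?thesis .
qed

text \<open>Exchanging Bob's part of two \<open>L\<close>-copy indices exchanges all of Bob's digits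
  at once, which is the exchange of his index in every single copy.\<close>

lemma partial_transpose_string_state:
  "partial_transpose (dA ^ L) (dB ^ L) (string_state dA dB X L c)
     = string_state dA dB (\<lambda>i. partial_transpose dA dB (X i)) L c"
proof (rule eq_matI)
  fix x y
  assume "x < dim_row (string_state dA dB (\<lambda>i. partial_transpose dA dB (X i)) L c)"
    "y < dim_col (string_state dA dB (\<lambda>i. partial_transpose dA dB (X i)) L c)"
  then have xy: "x < dA ^ L * dB ^ L" "y < dA ^ L * dB ^ L" by (auto simp: string_state_def)
  have m: "x mod dB ^ L < dB ^ L" "y mod dB ^ L < dB ^ L" using pos by simp_all
  have l: "x div dB ^ L * dB ^ L + y mod dB ^ L < dA ^ L * dB ^ L"
    "y div dB ^ L * dB ^ L + x mod dB ^ L < dA ^ L * dB ^ L"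
    using xy m by (simp_all add: pair_index_less less_mult_imp_div_less)
  have ci: "copy_index dA dB L l (a * dB ^ L + b)
      = (a div dA ^ l mod dA) * dB + b div dB ^ l mod dB" if "b < dB ^ L" for a b l
    using that pos by (simp add: copy_index_def)
  have "X (c l) $$ (copy_index dA dB L l (x div dB ^ L * dB ^ L + y mod dB ^ L),
        copy_index dA dB L l (y div dB ^ L * dB ^ L + x mod dB ^ L))
      = partial_transpose dA dB (X (c l)) $$ (copy_index dA dB L l x, copy_index dA dB L l y)" for l
    using copy_index_less m
    by (simp add: partial_transpose_def copy_index_div_mod ci)
  then show "partial_transpose (dA ^ L) (dB ^ L) (string_state dA dB X L c) $$ (x, y)
      = string_state dA dB (\<lambda>i. partial_transpose dA dB (X i)) L c $$ (x, y)"
    using xy l by (simp add: partial_transpose_def[of "dA ^ L"] string_state_def)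
qed (simp_all add: partial_transpose_def string_state_def)

end

section \<open>Success probabilities on one and on many copies\<close>

text \<open>The traces against all elements are nonnegative and add up to the trace of
  \<open>A\<close>.\<close>

lemma trace_prod_povm_bounds:
  assumes S: "finite S" and A: "psd_on S A" and N: "povm S n N" and i: "i < n"
  shows "0 \<le> trace_prod S A (N i)" "Re (trace_prod S A (N i)) \<le> Re (\<Sum>x\<in>S. A x x)"
proof -
  have nonneg: "0 \<le> trace_prod S A (N j)" if "j < n" for j
    using trace_prod_nonneg[OF S A] N that by (simp add: povm_def)
  then show "0 \<le> trace_prod S A (N i)" using i .
  have "Re (trace_prod S A (N i)) \<le> (\<Sum>j<n. Re (trace_prod S A (N j)))"
    using i nonneg by (intro member_le_sum) (auto simp: less_eq_complex_def)
  also have "\<dots> = Re (trace_prod S A (\<lambda>x y. \<Sum>j<n. N j x y))"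
    by (simp only: trace_prod_commute[of S A] trace_prod_sum Re_sum)
  also have "trace_prod S A (\<lambda>x y. \<Sum>j<n. N j x y) = (\<Sum>x\<in>S. A x x)"
    using N by (intro trace_prod_id S) (simp add: povm_def)
  finally show "Re (trace_prod S A (N i)) \<le> Re (\<Sum>x\<in>S. A x x)" .
qed

lemma Re_of_real_mult: "Re (complex_of_real a * z) = a * Re z"
  by simp

lemma success_eq:
  assumes "\<And>i. i < n \<Longrightarrow> X i \<in> carrier_mat d d" "\<And>i. i < n \<Longrightarrow> M i \<in> carrier_mat d d"
  shows "success n \<eta> X M = (\<Sum>i<n. \<eta> i * Re (trace_prod {..<d} (entries (X i)) (entries (M i))))"
  unfolding success_def by (intro sum.cong refl) (simp add: mat_trace_mult[OF assms])

text \<open>A real \<open>SUP\<close> is meaningful only over a set bounded above; this supplies the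
  bound for \<open>p_G\<close>.\<close>

lemma success_le_1:
  assumes E: "ensemble d n \<eta> \<rho>" and M: "measurement d n M"
  shows "success n \<eta> \<rho> M \<le> 1"
proof -
  have c: "M i \<in> carrier_mat d d" "\<rho> i \<in> carrier_mat d d" "psd_on {..<d} (entries (\<rho> i))" "0 \<le> \<eta> i"
    "mat_trace (\<rho> i) = 1" if "i < n" for i
    using E M that by (auto simp: ensemble_def density_operator_def psd_iff measurement_iff)
  have N: "povm {..<d} n (\<lambda>i. entries (M i))" using M by (simp add: measurement_iff)
  have "success n \<eta> \<rho> M = (\<Sum>i<n. \<eta> i * Re (trace_prod {..<d} (entries (\<rho> i)) (entries (M i))))"
    using c by (intro success_eq)
  also have "\<dots> \<le> (\<Sum>i<n. \<eta> i * 1)"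
  proof (intro sum_mono mult_left_mono)
    fix i assume "i \<in> {..<n}"
    then have i: "i < n" by simp
    have "Re (trace_prod {..<d} (entries (\<rho> i)) (entries (M i))) \<le> Re (\<Sum>x<d. \<rho> i $$ (x, x))"
      by (rule trace_prod_povm_bounds(2)[OF _ c(3)[OF i] N i]) simp
    also have "\<dots> = 1" using c(2,5)[OF i] by (simp add: mat_trace_def)
    finally show "Re (trace_prod {..<d} (entries (\<rho> i)) (entries (M i))) \<le> 1" .
    show "0 \<le> \<eta> i" using c i by blast
  qed
  also have "\<dots> = 1" using E by (simp add: ensemble_def)
  finally show ?thesis .
qed

text \<open>The constant guess. It makes the suprema range over nonempty sets and later gives the
  lower bound \<open>1 / n\<close>.\<close>

lemma measurement_announce:
  assumes "i\<^sub>0 < n"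
  shows "measurement d n (\<lambda>i. if i = i\<^sub>0 then 1\<^sub>m d else 0\<^sub>m d d)"
  unfolding measurement_iff povm_def
proof (intro conjI allI impI ballI)
  fix i
  have "psd_on {..<d} (entries (1\<^sub>m d))"
  proof -
    have "psd_on {..<d} (\<lambda>x y. if x = y then 1 else 0)"
      unfolding psd_on_def by (subst form_id) (simp_all add: less_eq_complex_def)
    then show ?thesis by (rule psd_on_cong[THEN iffD1, rotated]) simp
  qed
  moreover have "psd_on {..<d} (entries (0\<^sub>m d d))"
    by (simp add: psd_on_def form_def)
  ultimately show "psd_on {..<d} (entries (if i = i\<^sub>0 then 1\<^sub>m d else 0\<^sub>m d d))" by simp
next
  fix x y assume "x \<in> {..<d}" "y \<in> {..<d}"
  then have "(\<Sum>i<n. (if i = i\<^sub>0 then 1\<^sub>m d else 0\<^sub>m d d) $$ (x, y))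
     = (\<Sum>i<n. if i = i\<^sub>0 then (if x = y then 1 else 0) else (0::complex))"
    by (intro sum.cong refl) auto
  then show "(\<Sum>i<n. (if i = i\<^sub>0 then 1\<^sub>m d else 0\<^sub>m d d) $$ (x, y)) = (if x = y then 1 else (0::complex))"
    using assms by simp
qed auto

context
  fixes n dA dB :: nat and \<eta> :: "nat \<Rightarrow> real" and \<rho> :: "nat \<Rightarrow> complex mat"
  assumes n: "0 < n" and E: "ensemble (dA * dB) n \<eta> \<rho>"
begin

lemma ensembleD:
  assumes "i < n"
  shows "psd (dA * dB) (\<rho> i)" "(\<Sum>x<dA * dB. \<rho> i $$ (x, x)) = 1" "0 \<le> \<eta> i" "\<rho> i \<in> carrier_mat (dA * dB) (dA * dB)"
  using E assms by (auto simp: ensemble_def density_operator_def mat_trace_def psd_def)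

text \<open>A state has trace 1, impossible on the zero space.\<close>

lemma ensemble_dims: "0 < dA" "0 < dB"
  using ensembleD(2)[OF n] by (auto intro!: gr0I)

lemma strings_less: "c \<in> strings n L i \<Longrightarrow> l < L \<Longrightarrow> c l < n"
  by (auto simp: strings_def)

lemma string_prior_nonneg: "c \<in> strings n L i \<Longrightarrow> 0 \<le> string_prior \<eta> L c"
  unfolding string_prior_def by (intro prod_nonneg) (auto intro: ensembleD(3) strings_less)

lemma sum_string_prior: "(\<Sum>i<n. \<Sum>c\<in>strings n L i. string_prior \<eta> L c) = 1"
proof -
  have "(\<Sum>i<n. \<Sum>c\<in>strings n L i. string_prior \<eta> L c) = (\<Sum>c\<in>{..<L} \<rightarrow>\<^sub>E {..<n}. \<Prod>l<L. \<eta> (c l))"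
    unfolding string_prior_def by (rule sum_strings[OF n])
  also have "\<dots> = (\<Prod>l<L. \<Sum>i<n. \<eta> i)"
    by (rule prod_sum_PiE[symmetric]) auto
  finally show ?thesis using E by (simp add: ensemble_def)
qed

text \<open>The prior cancels the normalization of the state. If the prior is 0, its string priors
  are nonnegative with sum 0, so both sides vanish.\<close>

lemma success_multi:
  assumes M: "\<And>i. i < n \<Longrightarrow> M i \<in> carrier_mat (dA ^ L * dB ^ L) (dA ^ L * dB ^ L)"
  shows "success n (multi_prior n \<eta> L) (multi_state dA dB n \<eta> \<rho> L \<sigma>) M
    = (\<Sum>i<n. \<Sum>c\<in>strings n L i. string_prior \<eta> L c *
        Re (trace_prod {..<dA ^ L * dB ^ L} (entries (string_state dA dB \<rho> L c)) (entries (M i))))"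
  unfolding success_def
proof (rule sum.cong[OF refl])
  fix i assume "i \<in> {..<n}"
  let ?D = "dA ^ L * dB ^ L"
  let ?mp = "multi_prior n \<eta> L i"
  let ?T = "\<lambda>c. trace_prod {..<?D} (entries (string_state dA dB \<rho> L c)) (entries (M i))"
  have Mi: "M i \<in> carrier_mat ?D ?D" using M \<open>i \<in> {..<n}\<close> by simp
  show "?mp * Re (mat_trace (multi_state dA dB n \<eta> \<rho> L \<sigma> i * M i))
      = (\<Sum>c\<in>strings n L i. string_prior \<eta> L c * Re (?T c))"
  proof (cases "?mp = 0")
    case True
    then have "\<forall>c\<in>strings n L i. string_prior \<eta> L c = 0"
      unfolding multi_prior_def by (subst (asm) sum_nonneg_eq_0_iff) (auto intro: string_prior_nonneg)
    then show ?thesis using True by simp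
  next
    case False
    let ?S = "multi_state dA dB n \<eta> \<rho> L \<sigma> i"
    have "?S \<in> carrier_mat ?D ?D" using False by (simp add: multi_state_def mat_sum_def)
    then have "mat_trace (?S * M i) = trace_prod {..<?D} (entries ?S) (entries (M i))"
      by (rule mat_trace_mult[OF _ Mi])
    also have "\<dots> = trace_prod {..<?D} (\<lambda>x y. complex_of_real (1 / ?mp) *
        (\<Sum>c\<in>strings n L i. complex_of_real (string_prior \<eta> L c) * string_state dA dB \<rho> L c $$ (x, y))) (entries (M i))"
      using False by (intro trace_prod_cong) (auto simp: multi_state_def mat_sum_def string_state_def)
    also have "\<dots> = complex_of_real (1 / ?mp) * (\<Sum>c\<in>strings n L i. complex_of_real (string_prior \<eta> L c) * ?T c)"
      by (simp only: trace_prod_scale trace_prod_sum)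
    finally have "Re (mat_trace (?S * M i)) = 1 / ?mp * (\<Sum>c\<in>strings n L i. string_prior \<eta> L c * Re (?T c))"
      by (simp only: Re_complex_of_real Re_of_real_mult Re_sum)
    then show ?thesis using False by simp
  qed
qed

text \<open>Bounding string by string avoids showing first that the \<open>L\<close>-copy family is
  an \<open>ensemble\<close>.\<close>

lemma success_multi_le_1:
  assumes M: "measurement (dA ^ L * dB ^ L) n M"
  shows "success n (multi_prior n \<eta> L) (multi_state dA dB n \<eta> \<rho> L \<sigma>) M \<le> 1"
proof -
  let ?D = "dA ^ L * dB ^ L"
  have "success n (multi_prior n \<eta> L) (multi_state dA dB n \<eta> \<rho> L \<sigma>) M
    = (\<Sum>i<n. \<Sum>c\<in>strings n L i. string_prior \<eta> L c *
        Re (trace_prod {..<?D} (entries (string_state dA dB \<rho> L c)) (entries (M i))))"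
    using M by (intro success_multi) (simp add: measurement_iff)
  also have "\<dots> \<le> (\<Sum>i<n. \<Sum>c\<in>strings n L i. string_prior \<eta> L c * 1)"
  proof (intro sum_mono mult_left_mono string_prior_nonneg)
    fix i c assume ic: "i \<in> {..<n}" "c \<in> strings n L i"
    have "Re (trace_prod {..<?D} (entries (string_state dA dB \<rho> L c)) (entries (M i)))
        \<le> Re (\<Sum>x<?D. string_state dA dB \<rho> L c $$ (x, x))"
      using M ic strings_less[OF ic(2)] ensembleD(1)
      by (intro trace_prod_povm_bounds(2)[of _ _ n "\<lambda>i. entries (M i)"] psd_string_state ensemble_dims)
         (auto simp: measurement_iff)
    also have "\<dots> = 1"
      using strings_less[OF ic(2)] ensembleD(2) by (simp add: trace_string_state[OF ensemble_dims])
    finally show "Re (trace_prod {..<?D} (entries (string_state dA dB \<rho> L c)) (entries (M i))) \<le> 1" .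
  qed
  also have "\<dots> = 1" by (simp add: sum_string_prior)
  finally show ?thesis .
qed

lemma bdd_success_multi:
  "bdd_above (success n (multi_prior n \<eta> L) (multi_state dA dB n \<eta> \<rho> L \<sigma>) ` {M. measurement (dA ^ L * dB ^ L) n M})"
  by (rule bdd_aboveI[of _ 1]) (auto intro: success_multi_le_1)

section \<open>Perfect discrimination of many copies\<close>

text \<open>\<open>string_state\<close> is reused with elements of \<open>M\<close> in place of
  states: its value at \<open>c\<close> is the element for the outcomes \<open>c\<close> on the
  individual copies, here merged by their sum modulo \<open>n\<close>.\<close>

definition product_measurement :: "(nat \<Rightarrow> complex mat) \<Rightarrow> nat \<Rightarrow> nat \<Rightarrow> complex mat" where
  "product_measurement M L i = mat_sum (dA ^ L * dB ^ L) (string_state dA dB M L) (strings n L i)"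

lemma entries_product_measurement:
  assumes "x < dA ^ L * dB ^ L" "y < dA ^ L * dB ^ L"
  shows "product_measurement M L i $$ (x, y) = (\<Sum>c\<in>strings n L i. string_state dA dB M L c $$ (x, y))"
  using assms by (simp add: product_measurement_def mat_sum_def)

lemma measurement_product:
  assumes M: "measurement (dA * dB) n M"
  shows "measurement (dA ^ L * dB ^ L) n (product_measurement M L)"
  unfolding measurement_iff povm_def
proof (intro conjI allI impI ballI)
  let ?D = "dA ^ L * dB ^ L"
  show "product_measurement M L i \<in> carrier_mat ?D ?D" for i
    by (simp add: product_measurement_def mat_sum_def)
  show "psd_on {..<?D} (entries (product_measurement M L i))" if "i < n" for i
  proof -
    have "psd_on {..<?D} (\<lambda>x y. \<Sum>c\<in>strings n L i. string_state dA dB M L c $$ (x, y))"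
      using M strings_less by (intro psd_on_sum psd_string_state ensemble_dims) (auto simp: measurement_def)
    then show ?thesis
      by (rule psd_on_cong[THEN iffD1, rotated]) (simp add: entries_product_measurement)
  qed
  fix x y assume "x \<in> {..<?D}" "y \<in> {..<?D}"
  then have xy: "x < ?D" "y < ?D" by auto
  have cop: "copies dA dB L z \<in> {..<L} \<rightarrow>\<^sub>E {..<dA * dB}" if "z < ?D" for z
    using bij_betw_copies[OF ensemble_dims, of L] that by (auto simp: bij_betw_def)
  have "(\<Sum>i<n. product_measurement M L i $$ (x, y))
      = (\<Sum>c\<in>{..<L} \<rightarrow>\<^sub>E {..<n}. \<Prod>l<L. M (c l) $$ (copies dA dB L x l, copies dA dB L y l))"
    by (simp add: entries_product_measurement[OF xy] sum_strings[OF n] string_state_index[OF ensemble_dims xy])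
  also have "\<dots> = (\<Prod>l<L. \<Sum>j<n. M j $$ (copies dA dB L x l, copies dA dB L y l))"
    by (rule prod_sum_PiE[symmetric]) auto
  also have "\<dots> = (\<Prod>l<L. if copies dA dB L x l = copies dA dB L y l then 1 else 0)"
    using M cop[OF xy(1)] cop[OF xy(2)] by (intro prod.cong refl) (auto simp: measurement_iff povm_def PiE_iff)
  also have "\<dots> = (if \<forall>l<L. copies dA dB L x l = copies dA dB L y l then 1 else 0)"
    by (auto intro: prod_zero)
  also have "(\<forall>l<L. copies dA dB L x l = copies dA dB L y l) \<longleftrightarrow> copies dA dB L x = copies dA dB L y"
    using PiE_ext[OF cop[OF xy(1)] cop[OF xy(2)]] by auto
  also have "\<dots> \<longleftrightarrow> x = y"
    using bij_betw_copies[OF ensemble_dims, of L] xy by (auto simp: bij_betw_def inj_on_eq_iff)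
  finally show "(\<Sum>i<n. product_measurement M L i $$ (x, y)) = (if x = y then 1 else 0)" .
qed

text \<open>The left side is the probability that every copy is identified correctly. The announced
  sum can also be right when single outcomes are wrong; these additional terms are
  nonnegative.\<close>

lemma success_product:
  assumes M: "measurement (dA * dB) n M"
  shows "success n \<eta> \<rho> M ^ L
    \<le> success n (multi_prior n \<eta> L) (multi_state dA dB n \<eta> \<rho> L \<sigma>) (product_measurement M L)"
proof -
  let ?D = "dA ^ L * dB ^ L"
  let ?tr = "\<lambda>i. trace_prod {..<dA * dB} (entries (\<rho> i)) (entries (M i))"
  let ?T = "\<lambda>c c'. trace_prod {..<?D} (entries (string_state dA dB \<rho> L c)) (entries (string_state dA dB M L c'))"
  have N: "povm {..<dA * dB} n (\<lambda>i. entries (M i))" using M by (simp add: measurement_iff)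
  have nonneg: "0 \<le> ?T c c'" if "c \<in> strings n L i" "c' \<in> strings n L i" for c c' i
    using that strings_less ensembleD(1) M
    by (intro trace_prod_nonneg psd_string_state ensemble_dims) (auto simp: measurement_def)
  \<comment> \<open>Single-copy traces are real, so the real part of their product is the product of
    their real parts.\<close>
  have tr: "?tr i = of_real (Re (?tr i))" if "i < n" for i
    using trace_prod_povm_bounds(1)[OF _ _ N that, of "entries (\<rho> i)"] ensembleD(1)[OF that]
    by (simp add: psd_iff complex_eq_iff less_eq_complex_def)
  have "success n \<eta> \<rho> M ^ L = (\<Prod>l<L. \<Sum>i<n. \<eta> i * Re (?tr i))"
    using M ensembleD(4) by (subst success_eq[of _ _ "dA * dB"]) (auto simp: measurement_iff)
  also have "\<dots> = (\<Sum>c\<in>{..<L} \<rightarrow>\<^sub>E {..<n}. \<Prod>l<L. \<eta> (c l) * Re (?tr (c l)))"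
    by (rule prod_sum_PiE) auto
  also have "\<dots> = (\<Sum>i<n. \<Sum>c\<in>strings n L i. \<Prod>l<L. \<eta> (c l) * Re (?tr (c l)))"
    by (rule sum_strings[OF n, symmetric])
  also have "\<dots> = (\<Sum>i<n. \<Sum>c\<in>strings n L i. string_prior \<eta> L c * Re (?T c c))"
  proof (intro sum.cong refl)
    fix i c assume c: "c \<in> strings n L i"
    have "?T c c = (\<Prod>l<L. ?tr (c l))"
      by (rule trace_prod_string_states[OF ensemble_dims])
    also have "\<dots> = (\<Prod>l<L. of_real (Re (?tr (c l))))"
      using strings_less[OF c] tr by (intro prod.cong) auto
    finally have "Re (?T c c) = (\<Prod>l<L. Re (?tr (c l)))"
      by (simp only: of_real_prod[symmetric] Re_complex_of_real)
    then show "(\<Prod>l<L. \<eta> (c l) * Re (?tr (c l))) = string_prior \<eta> L c * Re (?T c c)"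
      by (simp add: string_prior_def prod.distrib)
  qed
  also have "\<dots> \<le> (\<Sum>i<n. \<Sum>c\<in>strings n L i. string_prior \<eta> L c * Re (\<Sum>c'\<in>strings n L i. ?T c c'))"
  proof (intro sum_mono mult_left_mono string_prior_nonneg)
    fix i c assume c: "c \<in> strings n L i"
    show "Re (?T c c) \<le> Re (\<Sum>c'\<in>strings n L i. ?T c c')"
      unfolding Re_sum using c nonneg[OF c]
      by (intro member_le_sum) (auto simp: less_eq_complex_def)
  qed
  also have "\<dots> = (\<Sum>i<n. \<Sum>c\<in>strings n L i. string_prior \<eta> L c *
      Re (trace_prod {..<?D} (entries (string_state dA dB \<rho> L c)) (entries (product_measurement M L i))))"
  proof -
    have "trace_prod {..<?D} (entries (string_state dA dB \<rho> L c)) (entries (product_measurement M L i))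
        = (\<Sum>c'\<in>strings n L i. ?T c c')" for c i
    proof -
      have "trace_prod {..<?D} (entries (string_state dA dB \<rho> L c)) (entries (product_measurement M L i))
         = trace_prod {..<?D} (\<lambda>x y. \<Sum>c'\<in>strings n L i. string_state dA dB M L c' $$ (x, y)) (entries (string_state dA dB \<rho> L c))"
        by (subst trace_prod_commute, rule trace_prod_cong) (simp_all add: entries_product_measurement)
      also have "\<dots> = (\<Sum>c'\<in>strings n L i. ?T c c')"
        unfolding trace_prod_sum by (intro sum.cong refl trace_prod_commute)
      finally show ?thesis .
    qed
    then show ?thesis by simp
  qed
  also have "\<dots> = success n (multi_prior n \<eta> L) (multi_state dA dB n \<eta> \<rho> L \<sigma>) (product_measurement M L)"
    using measurement_product[OF M, of L] by (intro success_multi[symmetric]) (simp add: measurement_iff)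
  finally show ?thesis .
qed

lemma p_G_multi_eq_1:
  assumes pG: "p_G dA dB n \<eta> \<rho> = 1"
  shows "p_G (dA ^ L) (dB ^ L) n (multi_prior n \<eta> L) (multi_state dA dB n \<eta> \<rho> L \<sigma>) = 1"
proof (rule antisym)
  let ?P = "p_G (dA ^ L) (dB ^ L) n (multi_prior n \<eta> L) (multi_state dA dB n \<eta> \<rho> L \<sigma>)"
  have ne: "{M. measurement d n M} \<noteq> {}" for d
    using measurement_announce[OF n] by blast
  show "?P \<le> 1"
    unfolding p_G_def using ne success_multi_le_1 by (intro cSUP_least) auto
  \<comment> \<open>\<open>p_G\<close> is a supremum and no optimal measurement is at hand, so the
    product measurement is built from one with success above \<open>e\<close>; afterwards
    \<open>e\<close> tends to 1.\<close>
  have pow: "e ^ L \<le> ?P" if "0 \<le> e" "e < 1" for e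
  proof -
    have "bdd_above (success n \<eta> \<rho> ` {M. measurement (dA * dB) n M})"
      by (rule bdd_aboveI[of _ 1]) (auto intro: success_le_1[OF E])
    moreover have "e < (SUP M\<in>{M. measurement (dA * dB) n M}. success n \<eta> \<rho> M)"
      using pG that by (simp add: p_G_def)
    ultimately obtain M where M: "measurement (dA * dB) n M" "e < success n \<eta> \<rho> M"
      using less_cSUP_iff[OF ne] by blast
    have "e ^ L \<le> success n \<eta> \<rho> M ^ L" using M that by (intro power_mono) auto
    also have "\<dots> \<le> success n (multi_prior n \<eta> L) (multi_state dA dB n \<eta> \<rho> L \<sigma>) (product_measurement M L)"
      by (rule success_product[OF M(1)])
    also have "\<dots> \<le> ?P"
      unfolding p_G_def using measurement_product[OF M(1)] by (intro cSUP_upper bdd_success_multi) auto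
    finally show ?thesis .
  qed
  have "(1 - inverse (real (Suc m))) ^ L \<le> ?P" for m
    by (rule pow) (simp_all add: field_simps)
  moreover have "(\<lambda>m. (1 - inverse (real (Suc m))) ^ L) \<longlonglongrightarrow> (1 - 0) ^ L"
    by (intro tendsto_intros LIMSEQ_inverse_real_of_nat)
  ultimately show "1 \<le> ?P"
    using LIMSEQ_le_const2 by fastforce
qed

text \<open>The \<open>n\<close> priors add up to 1, so one of them is at least
  \<open>1 / n\<close>; announcing its index regardless of the state succeeds with that
  probability.\<close>

lemma p_L_multi_ge:
  "1 / real n \<le> p_L (dA ^ L) (dB ^ L) n (multi_prior n \<eta> L) (multi_state dA dB n \<eta> \<rho> L \<sigma>)"
proof -
  let ?D = "dA ^ L * dB ^ L"
  let ?mp = "multi_prior n \<eta> L"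
  have "\<exists>i\<^sub>0<n. 1 / n \<le> ?mp i\<^sub>0"
  proof (rule ccontr)
    assume "\<not> (\<exists>i\<^sub>0<n. 1 / n \<le> ?mp i\<^sub>0)"
    then have "(\<Sum>i<n. ?mp i) < (\<Sum>i<n. 1 / n)"
      using n by (intro sum_strict_mono) auto
    then show False using sum_string_prior n by (simp add: multi_prior_def)
  qed
  then obtain i\<^sub>0 where i0: "i\<^sub>0 < n" "1 / n \<le> ?mp i\<^sub>0" by blast
  define M :: "nat \<Rightarrow> complex mat" where "M = (\<lambda>i. if i = i\<^sub>0 then 1\<^sub>m ?D else 0\<^sub>m ?D ?D)"
  have meas: "measurement ?D n M" unfolding M_def by (rule measurement_announce[OF i0(1)])
  have locc: "locc n (dA ^ L) (dB ^ L) M" unfolding M_def by (rule locc.announce[OF i0(1)])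
  have T1: "trace_prod {..<?D} (entries (string_state dA dB \<rho> L c)) (entries (M i))
      = (if i = i\<^sub>0 then 1 else 0)" if "c \<in> strings n L i" for c i
  proof (cases "i = i\<^sub>0")
    case True
    then have "trace_prod {..<?D} (entries (string_state dA dB \<rho> L c)) (entries (M i))
        = (\<Sum>x<?D. string_state dA dB \<rho> L c $$ (x, x))"
      by (intro trace_prod_id) (simp_all add: M_def)
    then show ?thesis
      using True strings_less[OF that] ensembleD(2) by (simp add: trace_string_state[OF ensemble_dims])
  next
    case False
    then show ?thesis by (simp add: trace_prod_def M_def)
  qed
  have "success n ?mp (multi_state dA dB n \<eta> \<rho> L \<sigma>) M
      = (\<Sum>i<n. \<Sum>c\<in>strings n L i. string_prior \<eta> L c *
        Re (trace_prod {..<?D} (entries (string_state dA dB \<rho> L c)) (entries (M i))))"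
    using meas by (intro success_multi) (simp add: measurement_iff)
  also have "\<dots> = (\<Sum>i<n. if i = i\<^sub>0 then ?mp i else 0)"
    by (intro sum.cong refl) (simp add: T1 multi_prior_def)
  also have "\<dots> = ?mp i\<^sub>0" using i0 by simp
  finally have s: "success n ?mp (multi_state dA dB n \<eta> \<rho> L \<sigma>) M = ?mp i\<^sub>0" .
  have "1 / real n \<le> success n ?mp (multi_state dA dB n \<eta> \<rho> L \<sigma>) M" using i0 s by simp
  also have "\<dots> \<le> p_L (dA ^ L) (dB ^ L) n ?mp (multi_state dA dB n \<eta> \<rho> L \<sigma>)"
    unfolding p_L_def using meas locc
    by (intro cSUP_upper bdd_above_mono[OF bdd_success_multi]) (auto simp: locc_measurement_def)
  finally show ?thesis .
qed

section \<open>The upper bound on LOCC discrimination\<close>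

text \<open>The prior is absorbed so that \<open>string_prior\<close> is distributed over the tensor
  factors.\<close>

definition weighted_pt :: "nat \<Rightarrow> nat \<Rightarrow> nat \<Rightarrow> complex" where
  "weighted_pt i x y = of_real (\<eta> i) * partial_transpose dA dB (\<rho> i) $$ (x, y)"

text \<open>The set under the supremum must be shown bounded. Partial transposes may fail to be
  positive, so the argument for states does not apply; instead, entries of measurement elements have
  modulus at most 1, which leaves the sum of the moduli of the entries of
  \<open>weighted_pt\<close>.\<close>

lemma success_le_q_G:
  assumes N: "povm {..<dA * dB} n N"
  shows "(\<Sum>i<n. Re (trace_prod {..<dA * dB} (N i) (weighted_pt i))) \<le> q_G dA dB n \<eta> \<rho>"
proof -
  let ?d = "dA * dB"
  let ?pt = "\<lambda>i. partial_transpose dA dB (\<rho> i)"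
  have succ: "success n \<eta> ?pt M = (\<Sum>i<n. Re (trace_prod {..<?d} (entries (M i)) (weighted_pt i)))"
    if "measurement ?d n M" for M
  proof -
    have "success n \<eta> ?pt M = (\<Sum>i<n. \<eta> i * Re (trace_prod {..<?d} (entries (?pt i)) (entries (M i))))"
      using that by (intro success_eq) (auto simp: measurement_iff)
    also have "\<dots> = (\<Sum>i<n. Re (trace_prod {..<?d} (weighted_pt i) (entries (M i))))"
      unfolding weighted_pt_def trace_prod_scale by simp
    finally show ?thesis by (simp only: trace_prod_commute)
  qed
  have "success n \<eta> ?pt M \<le> (\<Sum>i<n. \<Sum>x<?d. \<Sum>y<?d. cmod (weighted_pt i y x))" if "measurement ?d n M" for M
    unfolding succ[OF that]
  proof (intro sum_mono)
    fix i assume "i \<in> {..<n}"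
    then have c: "contraction {..<?d} 1 (entries (M i))"
      using that povm_contraction[of "{..<?d}" n "\<lambda>i. entries (M i)"] by (simp add: measurement_iff)
    have "Re (trace_prod {..<?d} (entries (M i)) (weighted_pt i)) \<le> cmod (trace_prod {..<?d} (entries (M i)) (weighted_pt i))"
      by (rule complex_Re_le_cmod)
    also have "\<dots> \<le> (\<Sum>x<?d. \<Sum>y<?d. cmod (weighted_pt i y x))"
      unfolding trace_prod_def
    proof (intro sum_norm_le)
      fix x y assume "x \<in> {..<?d}" "y \<in> {..<?d}"
      then have "cmod (M i $$ (x, y)) \<le> 1" using contraction_entry[OF _ c] by simp
      then show "cmod (M i $$ (x, y) * weighted_pt i y x) \<le> cmod (weighted_pt i y x)"
        by (simp add: norm_mult mult_left_le_one_le)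
    qed
    finally show "Re (trace_prod {..<?d} (entries (M i)) (weighted_pt i)) \<le> (\<Sum>x<?d. \<Sum>y<?d. cmod (weighted_pt i y x))" .
  qed
  then have bdd: "bdd_above (success n \<eta> ?pt ` {M. measurement ?d n M})"
    by (intro bdd_aboveI2) auto
  define M where "M = (\<lambda>i. mat ?d ?d (\<lambda>(x, y). N i x y))"
  have "povm {..<?d} n (\<lambda>i. entries (M i))"
  proof -
    have "psd_on {..<?d} (entries (M i)) \<longleftrightarrow> psd_on {..<?d} (N i)" for i
      by (rule psd_on_cong) (simp add: M_def)
    then show ?thesis using N by (simp add: povm_def M_def)
  qed
  then have M: "measurement ?d n M" by (simp add: measurement_iff M_def)
  have "(\<Sum>i<n. Re (trace_prod {..<?d} (N i) (weighted_pt i))) = success n \<eta> ?pt M"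
    unfolding succ[OF M] by (intro sum.cong refl arg_cong[of _ _ Re] trace_prod_cong) (simp_all add: M_def)
  also have "\<dots> \<le> q_G dA dB n \<eta> \<rho>"
    unfolding q_G_def using M bdd by (intro cSUP_upper) auto
  finally show ?thesis .
qed

text \<open>Partial transposition fixes the diagonal.\<close>

lemma sum_trace_weighted_pt: "(\<Sum>i<n. \<Sum>x<dA * dB. weighted_pt i x x) = 1"
proof -
  have "(\<Sum>i<n. \<Sum>x<dA * dB. weighted_pt i x x) = (\<Sum>i<n. of_real (\<eta> i))"
  proof (intro sum.cong refl)
    fix i assume "i \<in> {..<n}"
    then have "(\<Sum>x<dA * dB. \<rho> i $$ (x, x)) = 1" by (simp add: ensembleD(2))
    moreover have "(\<Sum>x<dA * dB. weighted_pt i x x) = of_real (\<eta> i) * (\<Sum>x<dA * dB. \<rho> i $$ (x, x))"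
      unfolding sum_distrib_left by (intro sum.cong refl) (simp add: weighted_pt_def partial_transpose_def)
    ultimately show "(\<Sum>x<dA * dB. weighted_pt i x x) = of_real (\<eta> i)" by simp
  qed
  also have "\<dots> = 1"
    using E by (simp add: ensemble_def flip: of_real_sum)
  finally show ?thesis .
qed

lemma trace_norm_fourier:
  assumes z: "z ^ n = 1" "z \<noteq> 1" "cmod z = 1"
  shows "trace_norm_le {..<dA * dB} (\<lambda>x y. \<Sum>i<n. z ^ i * weighted_pt i x y) (n * q_G dA dB n \<eta> \<rho> - 1)"
proof (rule trace_norm_le_of_success[OF _ n])
  fix i x y assume i: "i < n" and "x \<in> {..<dA * dB}" "y \<in> {..<dA * dB}"
  then have xy: "x < dA * dB" "y < dA * dB" by auto
  have "x div dB * dB + y mod dB < dA * dB" "y div dB * dB + x mod dB < dA * dB"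
    using xy ensemble_dims by (simp_all add: pair_index_less less_mult_imp_div_less)
  then show "weighted_pt i y x = cnj (weighted_pt i x y)"
    using xy psd_on_hermitian[of "{..<dA * dB}" "entries (\<rho> i)" "x div dB * dB + y mod dB" "y div dB * dB + x mod dB"]
      ensembleD(1)[OF i]
    by (simp add: weighted_pt_def partial_transpose_def psd_iff)
qed (use z success_le_q_G sum_trace_weighted_pt in auto)

lemma p_L_multi_le:
  assumes n1: "1 < n"
  shows "p_L (dA ^ L) (dB ^ L) n (multi_prior n \<eta> L) (multi_state dA dB n \<eta> \<rho> L \<sigma>)
    \<le> 1 / n + n * (n * q_G dA dB n \<eta> \<rho> - 1) ^ L"
  unfolding p_L_def
proof (rule cSUP_least)
  let ?D = "dA ^ L * dB ^ L"
  show "{M. locc_measurement (dA ^ L) (dB ^ L) n M} \<noteq> {}"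
    using measurement_announce[OF n] locc.announce[OF n] unfolding locc_measurement_def by blast
  fix M assume "M \<in> {M. locc_measurement (dA ^ L) (dB ^ L) n M}"
  then have meas: "measurement ?D n M" and locc: "locc n (dA ^ L) (dB ^ L) M"
    by (auto simp: locc_measurement_def)
  let ?N = "\<lambda>i. partial_transpose (dA ^ L) (dB ^ L) (M i)"
  let ?P = "{..<L} \<rightarrow>\<^sub>E {..<dA * dB}"
  let ?h = "inv_into {..<?D} (copies dA dB L)"
  \<comment> \<open>Positivity of the partial transposes makes the transposed family a measurement
    again; it is then carried to functions on the positions.\<close>
  have "povm {..<?D} n (\<lambda>i. entries (?N i))"
    using measurement_partial_transpose[OF meas] locc_ppt[OF locc] by (simp add: measurement_iff)
  from povm_bij[OF bij_betw_inv_into[OF bij_betw_copies[OF ensemble_dims, of L]] this]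
  have N: "povm ?P n (\<lambda>i f g. ?N i $$ (?h f, ?h g))" .
  define w where "w = cis (2 * pi / n)"
  have wk: "w ^ k = cis (2 * pi * real k / real n)" for k
    by (simp add: w_def DeMoivre mult_ac)
  have w: "w ^ n = 1" "cmod w = 1" using n by (simp_all add: wk, simp add: w_def)
  have inj: "inj_on (\<lambda>k. w ^ k) {..<n}"
    using bij_betw_roots_unity[OF n] by (simp add: bij_betw_def wk)
  have "success n (multi_prior n \<eta> L) (multi_state dA dB n \<eta> \<rho> L \<sigma>) M
    = (\<Sum>i<n. \<Sum>c\<in>strings n L i. string_prior \<eta> L c *
        Re (trace_prod {..<?D} (entries (string_state dA dB \<rho> L c)) (entries (M i))))"
    using meas by (intro success_multi) (simp add: measurement_iff)
  also have "\<dots> = (\<Sum>i<n. \<Sum>c\<in>strings n L i. Re (trace_prod ?P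
        (\<lambda>f g. \<Prod>l<L. weighted_pt (c l) (f l) (g l)) (\<lambda>f g. ?N i $$ (?h f, ?h g))))"
  proof (intro sum.cong refl)
    fix i c
    \<comment> \<open>Transposing state and element together keeps the trace, and the transposed
      string state is the string state of the transposes.\<close>
    have "trace_prod {..<?D} (entries (string_state dA dB \<rho> L c)) (entries (M i))
        = trace_prod {..<?D} (entries (string_state dA dB (\<lambda>i. partial_transpose dA dB (\<rho> i)) L c)) (entries (?N i))"
      by (simp only: trace_prod_partial_transpose partial_transpose_string_state[OF ensemble_dims, symmetric])
    also have "\<dots> = trace_prod ?P (\<lambda>f g. \<Prod>l<L. partial_transpose dA dB (\<rho> (c l)) $$ (f l, g l)) (\<lambda>f g. ?N i $$ (?h f, ?h g))"
      by (rule trace_prod_string_state[OF ensemble_dims])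
    finally have "of_real (string_prior \<eta> L c) * trace_prod {..<?D} (entries (string_state dA dB \<rho> L c)) (entries (M i))
       = trace_prod ?P (\<lambda>f g. of_real (string_prior \<eta> L c) * (\<Prod>l<L. partial_transpose dA dB (\<rho> (c l)) $$ (f l, g l))) (\<lambda>f g. ?N i $$ (?h f, ?h g))"
      by (simp only: trace_prod_scale)
    also have "\<dots> = trace_prod ?P (\<lambda>f g. \<Prod>l<L. weighted_pt (c l) (f l) (g l)) (\<lambda>f g. ?N i $$ (?h f, ?h g))"
      by (simp add: weighted_pt_def string_prior_def prod.distrib)
    finally show "string_prior \<eta> L c * Re (trace_prod {..<?D} (entries (string_state dA dB \<rho> L c)) (entries (M i)))
       = Re (trace_prod ?P (\<lambda>f g. \<Prod>l<L. weighted_pt (c l) (f l) (g l)) (\<lambda>f g. ?N i $$ (?h f, ?h g)))"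
      by (metis Re_of_real_mult)
  qed
  also have "\<dots> = (\<Sum>i<n. Re (trace_prod ?P
        (\<lambda>f g. \<Sum>c\<in>strings n L i. \<Prod>l<L. weighted_pt (c l) (f l) (g l)) (\<lambda>f g. ?N i $$ (?h f, ?h g))))"
    by (simp only: trace_prod_sum Re_sum)
  also have "\<dots> \<le> 1 / n + n * (n * q_G dA dB n \<eta> \<rho> - 1) ^ L"
  proof (rule success_strings_le[OF _ n1 _ w inj _ N])
    fix k assume "0 < k" "k < n"
    \<comment> \<open>For composite \<open>n\<close> the power \<open>w ^ k\<close> need not be
      primitive; an \<open>n\<close>-th root of unity other than 1 suffices.\<close>
    then have "w ^ k \<noteq> w ^ 0" using inj_on_eq_iff[OF inj, of k 0] n by simp
    moreover have "(w ^ k) ^ n = 1" using w(1) by (simp add: power_mult[symmetric] mult.commute[of k]) (simp add: power_mult)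
    ultimately show "trace_norm_le {..<dA * dB} (\<lambda>x y. \<Sum>i<n. (w ^ k) ^ i * weighted_pt i x y) (n * q_G dA dB n \<eta> \<rho> - 1)"
      using w(2) by (intro trace_norm_fourier) (auto simp: norm_power)
  next
    show "(\<Sum>i<n. \<Sum>x<dA * dB. weighted_pt i x x) = 1" by (rule sum_trace_weighted_pt)
  qed simp
  finally show "success n (multi_prior n \<eta> L) (multi_state dA dB n \<eta> \<rho> L \<sigma>) M \<le> 1 / n + n * (n * q_G dA dB n \<eta> \<rho> - 1) ^ L" .
qed

end

theorem mainTheorem6:
  fixes n dA dB :: nat
    and \<eta> :: "nat \<Rightarrow> real"
    and \<rho> :: "nat \<Rightarrow> complex mat"
    and \<sigma> :: "nat \<Rightarrow> nat \<Rightarrow> complex mat"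
  assumes "2 \<le> n"
    and "ensemble (dA * dB) n \<eta> \<rho>"
    and "p_G dA dB n \<eta> \<rho> = 1"
    and "q_G dA dB n \<eta> \<rho> < 2 / real n"
    and "\<And>L i. 1 \<le> L \<Longrightarrow> i < n \<Longrightarrow> density_operator (dA ^ L * dB ^ L) (\<sigma> L i)"
  shows "(\<forall>L\<ge>1. p_G (dA ^ L) (dB ^ L) n (multi_prior n \<eta> L) (multi_state dA dB n \<eta> \<rho> L (\<sigma> L)) = 1)
    \<and> (\<lambda>L. p_L (dA ^ L) (dB ^ L) n (multi_prior n \<eta> L) (multi_state dA dB n \<eta> \<rho> L (\<sigma> L)))
        \<longlonglongrightarrow> 1 / real n"
proof
  have n: "0 < n" "1 < n" using assms(1) by simp_all
  show "\<forall>L\<ge>1. p_G (dA ^ L) (dB ^ L) n (multi_prior n \<eta> L) (multi_state dA dB n \<eta> \<rho> L (\<sigma> L)) = 1"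
    using p_G_multi_eq_1[OF n(1) assms(2,3)] by blast
  let ?t = "n * q_G dA dB n \<eta> \<rho> - 1"
  \<comment> \<open>Exactly the hypothesis \<open>q_G < 2 / n\<close>.\<close>
  have "?t < 1" using assms(4) n by (simp add: field_simps)
  \<comment> \<open>Convergence of \<open>?t ^ L\<close> to 0 also takes a lower bound on
    \<open>?t\<close>. It bounds a trace norm, taken at the root \<open>cis (2 * pi / n)\<close>,
    which differs from 1 because \<open>n\<close> is at least 2.\<close>
  moreover have "0 \<le> ?t"
  proof -
    have "cis (2 * pi / n) ^ n = 1" using n by (simp add: DeMoivre)
    moreover have "cis (2 * pi / n) \<noteq> 1"
      using inj_onD[OF bij_betw_imp_inj_on[OF bij_betw_roots_unity[OF n(1)]], of 1 0] n by auto
    ultimately show ?thesis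
      by (intro trace_norm_le_nonneg[OF trace_norm_fourier[OF n(1) assms(2)]]) auto
  qed
  ultimately have "(\<lambda>L. 1 / n + n * ?t ^ L) \<longlonglongrightarrow> 1 / n + real n * 0"
    by (intro tendsto_intros LIMSEQ_realpow_zero)
  then have lim: "(\<lambda>L. 1 / n + n * ?t ^ L) \<longlonglongrightarrow> 1 / n" by simp
  show "(\<lambda>L. p_L (dA ^ L) (dB ^ L) n (multi_prior n \<eta> L) (multi_state dA dB n \<eta> \<rho> L (\<sigma> L)))
      \<longlonglongrightarrow> 1 / real n"
    using p_L_multi_ge[OF n(1) assms(2)] p_L_multi_le[OF n(1) assms(2) n(2)]
    by (intro tendsto_sandwich[OF _ _ tendsto_const lim] always_eventually allI)
qed

end
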